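(* Any minimal $G_1$-subflow $M(\mathcal P)$ of $S(\mathcal P)$ is a universal minimal flow for right actions of $\mathcal G(P)$ with proper anchor map: for every minimal flow $M$ of $\mathcal G(P)$ with proper anchor map there is a $\mathcal G(P)$-map from $M(\mathcal P)$ onto $M$.
   Context: All topological spaces are Hausdorff. $X$ is a locally compact, locally contractible space; $G$ is a metrizable topological group with a bounded compatible right-invariant metric. $p:P\to X$ is a principal right $G$-bundle: there is a continuous right action $P\times G\to P$ preserving the fibres of $p$, free and transitive on each fibre, and $p$ identifies $X$ with $P/G$; bundles are locally trivial, i.e. each point of $X$ has an open neighbourhood $U$ with a $G$-equivariant homeomorphism $p^{-1}(U)\cong U\times G$ over $U$. The groupoid $\mathcal G(P)=(G_0,G_1)$ has $G_0=X$ and $G_1=(P\times P)/G$ (quotient topology), the orbits $[u,v]$ of the diagonal action $(u,v)g=(ug,vg)$; $s([u,v])=p(u)$, $t([u,v])=p(v)$, composition $[u,v][v,w]=[u,w]$ (so $gh$ is defined when $t(g)=s(h)$), unit $u(x)=[v,v]$ for any $v\in p^{-1}(x)$. Fix $u_0\in P$ and $x_0=p(u_0)$. The space $s^{-1}(x_0)\subset G_1$ consists of the elements $[u_0,v]$, $v\in P$, and is identified with $P$ via $[u_0,v]\leftrightarrow v$; under this identification $p$ becomes $t:s^{-1}(x_0)\to X$. $R_{\mathcal P}=R_{\mathcal P,u_0}$ is the set of functions $f:s^{-1}(x_0)\to\mathbb C$ such that: (1) $f$ is bounded, continuous and zero outside $t^{-1}(K)$ for some compact $K\subset X$; (2) for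 every continuous local section $x\mapsto x'$ of $p:P\to X$ defined on an open set $U\subset X$ and every $\varepsilon>0$ there is an open neighbourhood $\mathcal V$ of $1\in G$ such that $|f([u_0gh,x'])-f([u_0h,x'])|<\varepsilon$ for all $g\in\mathcal V$, $h\in G$, $x\in U$. $S(\mathcal P)=\Omega(R_{\mathcal P})$ is the Gelfand space of $R_{\mathcal P}$: the nonzero $\mathbb C$-algebra homomorphisms $R_{\mathcal P}\to\mathbb C$ with the topology of pointwise convergence. The map $i:s^{-1}(x_0)\to S(\mathcal P)$, $i(\tau)(f)=f(\tau)$, is continuous and injective with dense image, and $P$ is regarded as a subset of $S(\mathcal P)$. The map $\rho_{\mathcal P}:S(\mathcal P)\to X$ is the continuous surjection dual to the inclusion $\eta\mapsto\eta\circ t$ of the algebra of compactly supported continuous functions on $X$ into $R_{\mathcal P}$; it extends $t$ and, by an earlier result of the paper, is proper. A right action of a topological groupoid $(G_0,G_1)$ on a space $Y$ with anchor map $\rho$ consists of continuous maps $\rho:Y\to G_0$ and $Y\times_{\rho,s}G_1\to Y$, $(y,g)\mapsto yg$, where $Y\times_{\rho,s}G_1=\{(y,g): s(g)=\rho(y)\}$, with $\rho(yg)=t(g)$, $(yh)g=y(hg)$, $y\,u(\rho(y))=y$. By an earlier result of the paper, the natural action $[u_0,v]\cdot[v,w]=[u_0,w]$ of $\mathcal G(P)$ on $P=s^{-1}(x_0)$ extends to a continuous right action $\alpha_P$ of $\mathcal G(P)$ on $S(\mathcal P)$ with anchor map $\rho_{\mathcal P}$. A $\mathcal G(P)$-map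 (or $G_1$-map) is a continuous map commuting with the anchor maps and the actions. A minimal flow is a nonempty space with a $\mathcal G(P)$-action with proper anchor map in which every orbit $yG_1=\{yg: s(g)=\rho(y)\}$ is dense (equivalently, with no proper nonempty closed invariant subset); a minimal subflow of $S(\mathcal P)$ is a closed invariant subset that is minimal.
   Formalization: The continuous action of G(P) on S(P) extending that on P is assumed to exist: with condition (2) of R_P in the stated order of g and h it does not exist for every G (it fails for X a point and G = Sym(N)), so the claim is proved wherever that action exists. *)

theory Defs
  imports "HOL-Analysis.Analysis" "HOL-Algebra.Group"
begin

section \<open>Topological preliminaries\<close>

text \<open>Inclusions of small open sets are null-homotopic. This is the weak form of local
  contractibility; it is implied by the existence of a base of contractible sets.\<close>

definition locally_contractible_space :: "'a topology \<Rightarrow> bool" where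
  "locally_contractible_space X \<longleftrightarrow>
     (\<forall>U x. openin X U \<and> x \<in> U \<longrightarrow>
        (\<exists>V c. openin X V \<and> x \<in> V \<and> V \<subseteq> U \<and>
           homotopic_with (\<lambda>_. True) (subtopology X V) (subtopology X U) id (\<lambda>_. c)))"

definition quotient_topology :: "'a topology \<Rightarrow> ('a \<Rightarrow> 'b) \<Rightarrow> 'b topology" where
  "quotient_topology Z q =
     topology (\<lambda>W. W \<subseteq> q ` topspace Z \<and> openin Z {z \<in> topspace Z. q z \<in> W})"

lemma istopology_quotient:
  "istopology (\<lambda>W. W \<subseteq> q ` topspace Z \<and> openin Z {z \<in> topspace Z. q z \<in> W})"
  unfolding istopology_def
proof (intro conjI allI impI; (elim conjE)?)
  fix S T
  assume "openin Z {z \<in> topspace Z. q z \<in> S}" "openin Z {z \<in> topspace Z. q z \<in> T}"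
  then have "openin Z ({z \<in> topspace Z. q z \<in> S} \<inter> {z \<in> topspace Z. q z \<in> T})"
    by (rule openin_Int)
  moreover have "{z \<in> topspace Z. q z \<in> S} \<inter> {z \<in> topspace Z. q z \<in> T}
      = {z \<in> topspace Z. q z \<in> S \<inter> T}"
    by blast
  ultimately show "openin Z {z \<in> topspace Z. q z \<in> S \<inter> T}" by simp
next
  fix \<K>
  assume *: "\<forall>K\<in>\<K>. K \<subseteq> q ` topspace Z \<and> openin Z {z \<in> topspace Z. q z \<in> K}"
  then have "openin Z (\<Union>K\<in>\<K>. {z \<in> topspace Z. q z \<in> K})"
    by blast
  moreover have "(\<Union>K\<in>\<K>. {z \<in> topspace Z. q z \<in> K}) = {z \<in> topspace Z. q z \<in> \<Union>\<K>}"
    by blast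
  ultimately show "openin Z {z \<in> topspace Z. q z \<in> \<Union>\<K>}" by simp
qed blast+

lemma openin_quotient_topology:
  "openin (quotient_topology Z q) W \<longleftrightarrow>
     W \<subseteq> q ` topspace Z \<and> openin Z {z \<in> topspace Z. q z \<in> W}"
  unfolding quotient_topology_def by (simp add: topology_inverse'[OF istopology_quotient])

lemma topspace_quotient_topology: "topspace (quotient_topology Z q) = q ` topspace Z"
proof -
  have "{z \<in> topspace Z. q z \<in> q ` topspace Z} = topspace Z" by blast
  then have "openin (quotient_topology Z q) (q ` topspace Z)"
    by (simp add: openin_quotient_topology)
  then show ?thesis
    by (metis openin_quotient_topology openin_subset openin_topspace subset_antisym)
qed

lemma quotient_map_quotient_topology: "quotient_map Z (quotient_topology Z q) q"
  by (auto simp: quotient_map_def topspace_quotient_topology openin_quotient_topology)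


section \<open>Groupoid actions, flows\<close>

text \<open>\<open>cmp \<G> a b\<close> is the composite written \<open>ab\<close>, defined when \<open>tgt \<G> a = src \<G> b\<close>.\<close>

record ('o, 'a) groupoid_data =
  objs :: "'o topology"
  arrs :: "'a topology"
  src :: "'a \<Rightarrow> 'o"
  tgt :: "'a \<Rightarrow> 'o"
  cmp :: "'a \<Rightarrow> 'a \<Rightarrow> 'a"
  idt :: "'o \<Rightarrow> 'a"

definition right_action ::
  "('o, 'a) groupoid_data \<Rightarrow> 'y topology \<Rightarrow> ('y \<Rightarrow> 'o) \<Rightarrow> ('y \<Rightarrow> 'a \<Rightarrow> 'y) \<Rightarrow> bool" where
  "right_action \<G> Y \<rho> \<alpha> \<longleftrightarrow>
     continuous_map Y (objs \<G>) \<rho> \<and>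
     continuous_map
       (subtopology (prod_topology Y (arrs \<G>)) {(y, g). src \<G> g = \<rho> y}) Y (\<lambda>(y, g). \<alpha> y g) \<and>
     (\<forall>y \<in> topspace Y. \<forall>g \<in> topspace (arrs \<G>). src \<G> g = \<rho> y \<longrightarrow> \<rho> (\<alpha> y g) = tgt \<G> g) \<and>
     (\<forall>y \<in> topspace Y. \<forall>h \<in> topspace (arrs \<G>). \<forall>g \<in> topspace (arrs \<G>).
        src \<G> h = \<rho> y \<and> tgt \<G> h = src \<G> g \<longrightarrow> \<alpha> (\<alpha> y h) g = \<alpha> y (cmp \<G> h g)) \<and>
     (\<forall>y \<in> topspace Y. \<alpha> y (idt \<G> (\<rho> y)) = y)"

definition orbit ::
  "('o, 'a) groupoid_data \<Rightarrow> ('y \<Rightarrow> 'o) \<Rightarrow> ('y \<Rightarrow> 'a \<Rightarrow> 'y) \<Rightarrow> 'y \<Rightarrow> 'y set" where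
  "orbit \<G> \<rho> \<alpha> y = {\<alpha> y g | g. g \<in> topspace (arrs \<G>) \<and> src \<G> g = \<rho> y}"

definition minimal_flow ::
  "('o, 'a) groupoid_data \<Rightarrow> 'y topology \<Rightarrow> ('y \<Rightarrow> 'o) \<Rightarrow> ('y \<Rightarrow> 'a \<Rightarrow> 'y) \<Rightarrow> bool" where
  "minimal_flow \<G> Y \<rho> \<alpha> \<longleftrightarrow>
     Hausdorff_space Y \<and> topspace Y \<noteq> {} \<and>
     right_action \<G> Y \<rho> \<alpha> \<and>
     proper_map Y (objs \<G>) \<rho> \<and>
     (\<forall>y \<in> topspace Y. Y closure_of (orbit \<G> \<rho> \<alpha> y) = topspace Y)"

text \<open>Neither properness of the anchor map of \<open>M\<close> nor the action axioms on \<open>M\<close> are part of the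
  following definition: they are inherited from the ambient flow \<open>Y\<close>.\<close>

definition minimal_subflow ::
  "('o, 'a) groupoid_data \<Rightarrow> 'y topology \<Rightarrow> ('y \<Rightarrow> 'o) \<Rightarrow> ('y \<Rightarrow> 'a \<Rightarrow> 'y) \<Rightarrow> 'y set \<Rightarrow> bool" where
  "minimal_subflow \<G> Y \<rho> \<alpha> M \<longleftrightarrow>
     closedin Y M \<and> M \<noteq> {} \<and>
     (\<forall>y \<in> M. orbit \<G> \<rho> \<alpha> y \<subseteq> M) \<and>
     (\<forall>y \<in> M. (subtopology Y M) closure_of (orbit \<G> \<rho> \<alpha> y) = M)"

definition groupoid_map ::
  "('o, 'a) groupoid_data \<Rightarrow> 'y topology \<Rightarrow> ('y \<Rightarrow> 'o) \<Rightarrow> ('y \<Rightarrow> 'a \<Rightarrow> 'y) \<Rightarrow>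
     'z topology \<Rightarrow> ('z \<Rightarrow> 'o) \<Rightarrow> ('z \<Rightarrow> 'a \<Rightarrow> 'z) \<Rightarrow> ('y \<Rightarrow> 'z) \<Rightarrow> bool" where
  "groupoid_map \<G> Y \<rho> \<alpha> Z \<rho>' \<alpha>' \<phi> \<longleftrightarrow>
     continuous_map Y Z \<phi> \<and>
     (\<forall>y \<in> topspace Y. \<rho>' (\<phi> y) = \<rho> y) \<and>
     (\<forall>y \<in> topspace Y. \<forall>g \<in> topspace (arrs \<G>).
        src \<G> g = \<rho> y \<longrightarrow> \<phi> (\<alpha> y g) = \<alpha>' (\<phi> y) g)"


section \<open>Principal bundles and their groupoids\<close>

definition topological_group :: "('g, 'b) monoid_scheme \<Rightarrow> 'g topology \<Rightarrow> bool" where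
  "topological_group G T \<longleftrightarrow>
     group G \<and> topspace T = carrier G \<and> Hausdorff_space T \<and>
     continuous_map (prod_topology T T) T (\<lambda>(g, h). g \<otimes>\<^bsub>G\<^esub> h) \<and>
     continuous_map T T (\<lambda>g. inv\<^bsub>G\<^esub> g)"

definition has_bounded_right_invariant_metric ::
  "('g, 'b) monoid_scheme \<Rightarrow> 'g topology \<Rightarrow> bool" where
  "has_bounded_right_invariant_metric G T \<longleftrightarrow>
     (\<exists>d. Metric_space (carrier G) d \<and>
          Metric_space.mtopology (carrier G) d = T \<and>
          Metric_space.mbounded (carrier G) d (carrier G) \<and>
          (\<forall>g \<in> carrier G. \<forall>h \<in> carrier G. \<forall>k \<in> carrier G.
             d (g \<otimes>\<^bsub>G\<^esub> k) (h \<otimes>\<^bsub>G\<^esub> k) = d g h))"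

record ('g, 'p, 'x) bundle_data =
  grp :: "'g monoid"
  grp_top :: "'g topology"
  tot_space :: "'p topology"
  base_space :: "'x topology"
  proj :: "'p \<Rightarrow> 'x"
  ract :: "'p \<Rightarrow> 'g \<Rightarrow> 'p"

definition principal_bundle :: "('g, 'p, 'x) bundle_data \<Rightarrow> bool" where
  "principal_bundle B \<longleftrightarrow>
     topological_group (grp B) (grp_top B) \<and>
     Hausdorff_space (tot_space B) \<and> Hausdorff_space (base_space B) \<and>
     continuous_map (prod_topology (tot_space B) (grp_top B)) (tot_space B) (\<lambda>(v, g). ract B v g) \<and>
     (\<forall>v \<in> topspace (tot_space B). ract B v \<one>\<^bsub>grp B\<^esub> = v) \<and>
     (\<forall>v \<in> topspace (tot_space B). \<forall>g \<in> carrier (grp B). \<forall>h \<in> carrier (grp B).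
        ract B (ract B v g) h = ract B v (g \<otimes>\<^bsub>grp B\<^esub> h)) \<and>
     (\<forall>v \<in> topspace (tot_space B). \<forall>g \<in> carrier (grp B). proj B (ract B v g) = proj B v) \<and>
     (\<forall>v \<in> topspace (tot_space B). \<forall>w \<in> topspace (tot_space B). proj B v = proj B w \<longrightarrow>
        (\<exists>!g. g \<in> carrier (grp B) \<and> ract B v g = w)) \<and>
     quotient_map (tot_space B) (base_space B) (proj B) \<and>
     (\<forall>x \<in> topspace (base_space B). \<exists>U \<phi>. openin (base_space B) U \<and> x \<in> U \<and>
        homeomorphic_map (subtopology (tot_space B) {v \<in> topspace (tot_space B). proj B v \<in> U})
          (prod_topology (subtopology (base_space B) U) (grp_top B)) \<phi> \<and>
        (\<forall>v \<in> topspace (tot_space B). proj B v \<in> U \<longrightarrow>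
           fst (\<phi> v) = proj B v \<and>
           (\<forall>g \<in> carrier (grp B). \<phi> (ract B v g) = (proj B v, snd (\<phi> v) \<otimes>\<^bsub>grp B\<^esub> g))))"

definition diag_orbit :: "('g, 'p, 'x) bundle_data \<Rightarrow> 'p \<Rightarrow> 'p \<Rightarrow> ('p \<times> 'p) set" where
  "diag_orbit B v w = {(ract B v g, ract B w g) | g. g \<in> carrier (grp B)}"

text \<open>An arrow is an orbit, hence a relation on \<open>P\<close>. As the action is free and transitive on the
  fibres, the composite \<open>[u,v][v,w] = [u,w]\<close> is relational composition, and the orbit \<open>[v,v]\<close> is
  the diagonal of the fibre containing \<open>v\<close>.\<close>

definition gauge_groupoid :: "('g, 'p, 'x) bundle_data \<Rightarrow> ('x, ('p \<times> 'p) set) groupoid_data" where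
  "gauge_groupoid B =
     \<lparr> objs = base_space B,
       arrs = quotient_topology (prod_topology (tot_space B) (tot_space B)) (\<lambda>(v, w). diag_orbit B v w),
       src = (\<lambda>a. the_elem (proj B ` Domain a)),
       tgt = (\<lambda>a. the_elem (proj B ` Range a)),
       cmp = (\<lambda>a b. a O b),
       idt = (\<lambda>x. Id_on {v \<in> topspace (tot_space B). proj B v = x}) \<rparr>"

lemma gauge_groupoid_orbits:
  assumes B: "principal_bundle B"
    and u: "u \<in> topspace (tot_space B)" and v: "v \<in> topspace (tot_space B)" and w: "w \<in> topspace (tot_space B)"
  shows "src (gauge_groupoid B) (diag_orbit B u v) = proj B u"
    and "tgt (gauge_groupoid B) (diag_orbit B u v) = proj B v"
    and "cmp (gauge_groupoid B) (diag_orbit B u v) (diag_orbit B v w) = diag_orbit B u w"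
    and "idt (gauge_groupoid B) (proj B v) = diag_orbit B v v"
proof -
  have grp: "group (grp B)" and Tg: "topspace (grp_top B) = carrier (grp B)"
    using B by (auto simp: principal_bundle_def topological_group_def)
  then have one: "\<one>\<^bsub>grp B\<^esub> \<in> carrier (grp B)"
    by (simp add: group.is_monoid monoid.one_closed)
  have fib: "proj B (ract B z g) = proj B z" if "z \<in> topspace (tot_space B)" "g \<in> carrier (grp B)" for z g
    using B that by (auto simp: principal_bundle_def)
  have cl: "ract B z g \<in> topspace (tot_space B)" if "z \<in> topspace (tot_space B)" "g \<in> carrier (grp B)" for z g
  proof -
    have "continuous_map (prod_topology (tot_space B) (grp_top B)) (tot_space B) (\<lambda>(v, g). ract B v g)"
      using B by (simp add: principal_bundle_def)
    then have "(\<lambda>(v, g). ract B v g) (z, g) \<in> topspace (tot_space B)"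
      by (rule continuous_map_image_subset_topspace[THEN subsetD, OF _ imageI])
        (simp add: that Tg)
    then show ?thesis by simp
  qed
  have free: "\<exists>!g. g \<in> carrier (grp B) \<and> ract B z g = z'"
    if "z \<in> topspace (tot_space B)" "z' \<in> topspace (tot_space B)" "proj B z = proj B z'" for z z'
    using B that by (auto simp: principal_bundle_def)
  have dom_u: "Domain (diag_orbit B u v) = ract B u ` carrier (grp B)"
    by (auto simp: diag_orbit_def)
  have "proj B ` Domain (diag_orbit B u v) = {proj B u}"
    unfolding dom_u using one fib[OF u] by (auto simp: image_iff)
  then show "src (gauge_groupoid B) (diag_orbit B u v) = proj B u"
    by (simp add: gauge_groupoid_def)
  have dom_v: "Range (diag_orbit B u v) = ract B v ` carrier (grp B)"
    by (auto simp: diag_orbit_def)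
  have "proj B ` Range (diag_orbit B u v) = {proj B v}"
    unfolding dom_v using one fib[OF v] by (auto simp: image_iff)
  then show "tgt (gauge_groupoid B) (diag_orbit B u v) = proj B v"
    by (simp add: gauge_groupoid_def)
  have inj: "g = h" if "g \<in> carrier (grp B)" "h \<in> carrier (grp B)" "ract B v g = ract B v h" for g h
    using free[OF v cl[OF v that(1)]] fib[OF v that(1)] that by metis
  show "cmp (gauge_groupoid B) (diag_orbit B u v) (diag_orbit B v w) = diag_orbit B u w"
    using inj by (fastforce simp: gauge_groupoid_def diag_orbit_def)
  show "idt (gauge_groupoid B) (proj B v) = diag_orbit B v v"
  proof (intro equalityI subsetI)
    fix z assume "z \<in> idt (gauge_groupoid B) (proj B v)"
    then show "z \<in> diag_orbit B v v"
      using free[OF v] by (fastforce simp: gauge_groupoid_def diag_orbit_def Id_on_def)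
  next
    fix z assume "z \<in> diag_orbit B v v"
    then show "z \<in> idt (gauge_groupoid B) (proj B v)"
      using cl[OF v] fib[OF v] by (auto simp: gauge_groupoid_def diag_orbit_def Id_on_def)
  qed
qed


section \<open>The algebra \<open>R\<^sub>P\<close>, its Gelfand space, and the extended action\<close>

definition source_fibre :: "('o, 'a) groupoid_data \<Rightarrow> 'o \<Rightarrow> 'a topology" where
  "source_fibre \<G> x = subtopology (arrs \<G>) {a. src \<G> a = x}"

text \<open>A function on \<open>s\<^sup>-\<^sup>1(x\<^sub>0)\<close> is represented by its extension by zero, so that the algebra
  operations of \<open>R\<^sub>P\<close> are the pointwise operations on total functions.\<close>

definition R_alg :: "('g, 'p, 'x) bundle_data \<Rightarrow> 'p \<Rightarrow> (('p \<times> 'p) set \<Rightarrow> complex) set" where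
  "R_alg B u0 = (let \<G> = gauge_groupoid B; F = source_fibre \<G> (proj B u0) in
     {f. (\<forall>\<tau>. \<tau> \<notin> topspace F \<longrightarrow> f \<tau> = 0) \<and>
         bounded (f ` topspace F) \<and>
         continuous_map F euclidean f \<and>
         (\<exists>K. compactin (base_space B) K \<and> (\<forall>\<tau> \<in> topspace F. tgt \<G> \<tau> \<notin> K \<longrightarrow> f \<tau> = 0)) \<and>
         (\<forall>U \<sigma> \<epsilon>. openin (base_space B) U \<and>
            continuous_map (subtopology (base_space B) U) (tot_space B) \<sigma> \<and>
            (\<forall>x \<in> U. proj B (\<sigma> x) = x) \<and> \<epsilon> > 0 \<longrightarrow>
            (\<exists>V. openin (grp_top B) V \<and> \<one>\<^bsub>grp B\<^esub> \<in> V \<and>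
               (\<forall>g \<in> V. \<forall>h \<in> carrier (grp B). \<forall>x \<in> U.
                  cmod (f (diag_orbit B (ract B u0 (g \<otimes>\<^bsub>grp B\<^esub> h)) (\<sigma> x))
                        - f (diag_orbit B (ract B u0 h) (\<sigma> x))) < \<epsilon>)))})"

text \<open>Characters are functions on \<open>A\<close> only, represented as elements of \<open>extensional A\<close>
  (the points of the product topology indexed by \<open>A\<close> are extensional).\<close>

definition Gelfand_space :: "('a \<Rightarrow> complex) set \<Rightarrow> (('a \<Rightarrow> complex) \<Rightarrow> complex) topology" where
  "Gelfand_space A = subtopology (product_topology (\<lambda>_. euclidean) A)
     {\<xi>. (\<forall>f \<in> A. \<forall>g \<in> A. \<xi> (\<lambda>\<tau>. f \<tau> + g \<tau>) = \<xi> f + \<xi> g) \<and>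
         (\<forall>f \<in> A. \<forall>g \<in> A. \<xi> (\<lambda>\<tau>. f \<tau> * g \<tau>) = \<xi> f * \<xi> g) \<and>
         (\<forall>c. \<forall>f \<in> A. \<xi> (\<lambda>\<tau>. c * f \<tau>) = c * \<xi> f) \<and>
         (\<exists>f \<in> A. \<xi> f \<noteq> 0)}"

definition S_space ::
  "('g, 'p, 'x) bundle_data \<Rightarrow> 'p \<Rightarrow> ((('p \<times> 'p) set \<Rightarrow> complex) \<Rightarrow> complex) topology" where
  "S_space B u0 = Gelfand_space (R_alg B u0)"

definition S_embed ::
  "('g, 'p, 'x) bundle_data \<Rightarrow> 'p \<Rightarrow> ('p \<times> 'p) set \<Rightarrow> (('p \<times> 'p) set \<Rightarrow> complex) \<Rightarrow> complex" where
  "S_embed B u0 \<tau> = (\<lambda>f \<in> R_alg B u0. f \<tau>)"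

definition compactly_supported :: "'x topology \<Rightarrow> ('x \<Rightarrow> complex) set" where
  "compactly_supported X =
     {\<eta>. continuous_map X euclidean \<eta> \<and>
         (\<exists>K. compactin X K \<and> (\<forall>x \<in> topspace X - K. \<eta> x = 0))}"

text \<open>The dual of \<open>\<eta> \<mapsto> \<eta> \<circ> t\<close> sends a character \<open>\<xi>\<close> to the character \<open>\<eta> \<mapsto> \<xi> (\<eta> \<circ> t)\<close> of the algebra
  of compactly supported functions on the base, that is, to the point at which the latter is
  evaluation. As above, \<open>\<eta> \<circ> t\<close> is extended by zero.\<close>

definition S_anchor ::
  "('g, 'p, 'x) bundle_data \<Rightarrow> 'p \<Rightarrow> ((('p \<times> 'p) set \<Rightarrow> complex) \<Rightarrow> complex) \<Rightarrow> 'x" where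
  "S_anchor B u0 \<xi> = (let \<G> = gauge_groupoid B; F = source_fibre \<G> (proj B u0) in
     THE x. x \<in> topspace (base_space B) \<and>
       (\<forall>\<eta> \<in> compactly_supported (base_space B).
          \<xi> (\<lambda>\<tau>. if \<tau> \<in> topspace F then \<eta> (tgt \<G> \<tau>) else 0) = \<eta> x))"

text \<open>By density of \<open>P\<close> in \<open>S(P)\<close> and local triviality there is at most one such \<open>\<alpha>\<close>, up to
  its values at pairs \<open>(\<xi>, g)\<close> that are not composable.\<close>

definition extended_action ::
  "('g, 'p, 'x) bundle_data \<Rightarrow> 'p \<Rightarrow>
     (((('p \<times> 'p) set \<Rightarrow> complex) \<Rightarrow> complex) \<Rightarrow> ('p \<times> 'p) set \<Rightarrow>
      ((('p \<times> 'p) set \<Rightarrow> complex) \<Rightarrow> complex)) \<Rightarrow> bool" where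
  "extended_action B u0 \<alpha> \<longleftrightarrow>
     right_action (gauge_groupoid B) (S_space B u0) (S_anchor B u0) \<alpha> \<and>
     (\<forall>v \<in> topspace (tot_space B). \<forall>w \<in> topspace (tot_space B).
        \<alpha> (S_embed B u0 (diag_orbit B u0 v)) (diag_orbit B v w)
          = S_embed B u0 (diag_orbit B u0 w))"

end

theory Submission
  imports Defs
begin

text \<open>Let \<open>M\<close> be a flow with proper anchor map and \<open>m\<^sub>0\<close> a point of \<open>M\<close> over \<open>x\<^sub>0\<close>. For every compactly
  supported \<open>f\<close> on \<open>M\<close> the function \<open>[u\<^sub>0,v] \<mapsto> f (m\<^sub>0[u\<^sub>0,v])\<close> lies in \<open>R\<^sub>P\<close>, so a character \<open>\<xi>\<close> of \<open>R\<^sub>P\<close>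
  induces a nonzero character of the algebra of compactly supported functions on \<open>M\<close>, that is, a
  point of \<open>M\<close>. This extends the orbit map of \<open>m\<^sub>0\<close> to a continuous map \<open>\<Phi>\<close> from \<open>S(P)\<close> to \<open>M\<close>
  over the base, which is equivariant because \<open>P\<close> is dense in \<open>S(P)\<close>. As the anchor map of \<open>S(P)\<close> is
  proper, \<open>\<Phi>\<close> maps a closed invariant set onto a closed invariant set, hence onto \<open>M\<close> when \<open>M\<close> is
  minimal.\<close>

section \<open>Topological preliminaries\<close>

text \<open>The crux is membership in \<open>R\<close>. Read on \<open>P\<close>, its uniformity
  condition asks that the values at \<open>v g\<close> and \<open>v\<close> be close for
  \<open>g\<close> near 1, uniformly in \<open>v\<close>. In a fibre with \<open>v = e k\<close> the
  perturbation \<open>e k g\<close> stands to the right of \<open>k\<close>, which runs through the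
  whole group, whereas the arrow \<open>[e, e b]\<close> sends the orbit point of \<open>e k\<close>
  to that of \<open>e b k\<close>: compactness of the fibres of the flow controls only the left
  side. The extended action on \<open>S\<close> supplies the other side, so it is needed before the
  factor map exists and not only for its equivariance. Characters are purely algebraic, with no
  assumption on norms or conjugation. What is needed about them rests on one fact: finitely many of
  their values can be approximated by evaluation at a point of \<open>P\<close>. This holds because
  \<open>R\<close> is closed under conjugation and under division by functions cut off away from
  zero.\<close>

lemma bump_function:
  assumes lc: "locally_compact_space Z" and T2: "Hausdorff_space Z"
    and K: "compactin Z K" and W: "openin Z W" and KW: "K \<subseteq> W"
  obtains \<psi> L where "\<psi> \<in> compactly_supported Z" "\<forall>z\<in>K. \<psi> z = 1"
    "compactin Z L" "L \<subseteq> W" "\<forall>z\<in>topspace Z - L. \<psi> z = 0"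
    "\<forall>z\<in>topspace Z. cmod (\<psi> z) \<le> 1"
proof -
  \<comment> \<open>The compact \<open>L\<close> is found inside \<open>W\<close>, itself a locally
    compact Hausdorff space, so that the support stays in \<open>W\<close>; Urysohn's lemma is then
    applied in \<open>Z\<close> to \<open>K\<close> and the complement of \<open>U\<close>.\<close>
  have "locally_compact_space (subtopology Z W)"
    using lc T2 W locally_compact_space_open_subset by blast
  moreover have "Hausdorff_space (subtopology Z W)"
    using T2 by (rule Hausdorff_space_subtopology)
  moreover have "compactin (subtopology Z W) K"
    using K KW by (simp add: compactin_subtopology)
  ultimately obtain U L where UL: "openin (subtopology Z W) U" "compactin (subtopology Z W) L"
    "K \<subseteq> U" "U \<subseteq> L"
    using locally_compact_space_compact_closed_compact by metis
  have U: "openin Z U" using UL(1) W by (rule openin_trans_full)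
  have L: "compactin Z L" "L \<subseteq> W" using UL(2) by (auto simp: compactin_subtopology)
  have "completely_regular_space Z"
    using lc T2 locally_compact_regular_imp_completely_regular_space by blast
  moreover have "disjnt K (topspace Z - U)" using UL(3) by (auto simp: disjnt_def)
  ultimately obtain f where f: "continuous_map Z (top_of_set {0..1::real}) f"
     "f ` (topspace Z - U) \<subseteq> {0}" "f ` K \<subseteq> {1}"
    using Urysohn_completely_regular_compact_closed[of 0 1 Z K "topspace Z - U"] K U by auto
  have cf: "continuous_map Z euclideanreal f"
    using f(1) continuous_map_into_fulltopology by blast
  have r: "f z \<in> {0..1}" if "z \<in> topspace Z" for z
    using f(1) that by (auto simp: continuous_map_in_subtopology)
  show thesis
  proof
    have 0: "complex_of_real (f z) = 0" if "z \<in> topspace Z - L" for z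
      using f(2) UL(4) that by auto
    have "continuous_map Z euclidean (complex_of_real \<circ> f)"
      by (rule continuous_map_compose[OF cf]) (auto intro: continuous_intros)
    with 0 L(1) show "(\<lambda>z. complex_of_real (f z)) \<in> compactly_supported Z"
      unfolding compactly_supported_def o_def by blast
    show "\<forall>z\<in>topspace Z - L. complex_of_real (f z) = 0" using 0 by blast
    show "\<forall>z\<in>K. complex_of_real (f z) = 1" using f(3) by auto
    show "\<forall>z\<in>topspace Z. cmod (complex_of_real (f z)) \<le> 1" using r by auto
  qed (use L in auto)
qed

lemma bump_function_at:
  assumes "locally_compact_space Z" "Hausdorff_space Z" and W: "openin Z W" and z: "z \<in> W"
  obtains \<psi> L where "\<psi> \<in> compactly_supported Z" "\<psi> z = 1"
    "compactin Z L" "L \<subseteq> W" "\<forall>z\<in>topspace Z - L. \<psi> z = 0"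
    "\<forall>z\<in>topspace Z. cmod (\<psi> z) \<le> 1"
proof -
  have "compactin Z {z}" using openin_subset[OF W] z by auto
  then show thesis
  proof (rule bump_function[OF assms(1,2) _ W, of "{z}"])
    fix \<psi> L
    assume "\<psi> \<in> compactly_supported Z" "\<forall>y\<in>{z}. \<psi> y = 1" "compactin Z L" "L \<subseteq> W"
      "\<forall>z\<in>topspace Z - L. \<psi> z = 0" "\<forall>z\<in>topspace Z. cmod (\<psi> z) \<le> 1"
    then show thesis by (intro that[of \<psi> L]) simp_all
  qed (use z in simp)
qed

text \<open>A bump at \<open>x\<close> supported off \<open>y\<close> tells them apart. Points of
  the base and of the flow are recovered in this way from functionals on compactly supported
  functions.\<close>

lemma compactly_supported_separates:
  assumes "locally_compact_space Z" "Hausdorff_space Z" "x \<in> topspace Z" "y \<in> topspace Z"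
    and eq: "\<And>f. f \<in> compactly_supported Z \<Longrightarrow> f x = f y"
  shows "x = y"
proof (rule ccontr)
  assume "x \<noteq> y"
  have "openin Z (topspace Z - {y})"
    using assms by (simp add: Hausdorff_imp_t1_space closedin_t1_singleton openin_diff)
  moreover have "x \<in> topspace Z - {y}" using assms(3) \<open>x \<noteq> y\<close> by simp
  ultimately obtain \<psi> L where \<psi>: "\<psi> \<in> compactly_supported Z" "\<psi> x = 1"
    "compactin Z L" "L \<subseteq> topspace Z - {y}" "\<forall>z\<in>topspace Z - L. \<psi> z = 0"
    "\<forall>z\<in>topspace Z. cmod (\<psi> z) \<le> 1"
    using bump_function_at[OF assms(1,2)] by blast
  have "\<psi> y = 0" using \<psi>(4) \<psi>(5) assms(4) by blast
  with eq[OF \<psi>(1)] \<psi>(2) show False by simp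
qed

text \<open>A locally compact Hausdorff space carries the initial topology of its compactly
  supported functions: where a bump at \<open>\<phi> y\<close> supported in \<open>W\<close> is
  nonzero, one is inside \<open>W\<close>.\<close>

lemma continuous_map_compactly_supportedI:
  assumes lc: "locally_compact_space Z" and T2: "Hausdorff_space Z"
    and into: "\<And>y. y \<in> topspace Y \<Longrightarrow> \<phi> y \<in> topspace Z"
    and cont: "\<And>f. f \<in> compactly_supported Z \<Longrightarrow> continuous_map Y euclidean (\<lambda>y. f (\<phi> y))"
  shows "continuous_map Y Z \<phi>"
  unfolding continuous_map_def
proof (intro conjI allI impI)
  show "\<phi> \<in> topspace Y \<rightarrow> topspace Z" using into by auto
  fix W assume W: "openin Z W"
  show "openin Y {y \<in> topspace Y. \<phi> y \<in> W}"
  proof (subst openin_subopen, intro ballI)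
    fix y assume y: "y \<in> {y \<in> topspace Y. \<phi> y \<in> W}"
    then have "\<phi> y \<in> W" by simp
    then obtain \<psi> L where \<psi>: "\<psi> \<in> compactly_supported Z" "\<psi> (\<phi> y) = 1"
      "compactin Z L" "L \<subseteq> W" "\<forall>z\<in>topspace Z - L. \<psi> z = 0"
      "\<forall>z\<in>topspace Z. cmod (\<psi> z) \<le> 1"
      using bump_function_at[OF lc T2 W] by blast
    have sub: "\<phi> y \<in> W" if "y \<in> topspace Y" "\<psi> (\<phi> y) \<noteq> 0" for y
      using \<psi>(4) \<psi>(5) into[OF that(1)] that(2) by blast
    have "openin Y {y \<in> topspace Y. \<psi> (\<phi> y) \<in> - {0}}"
      by (rule openin_continuous_map_preimage[OF cont[OF \<psi>(1)]]) auto
    then show "\<exists>T. openin Y T \<and> y \<in> T \<and> T \<subseteq> {y \<in> topspace Y. \<phi> y \<in> W}"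
      using \<psi>(2) y sub by (intro exI[of _ "{y \<in> topspace Y. \<psi> (\<phi> y) \<in> - {0}}"]) auto
  qed
qed

section \<open>Compact supports and proper maps\<close>

lemma compactly_supported_bounded:
  assumes "f \<in> compactly_supported Z"
  obtains b where "b > 0" "\<And>z. z \<in> topspace Z \<Longrightarrow> cmod (f z) \<le> b"
proof -
  obtain K where f: "continuous_map Z euclidean f" and K: "compactin Z K"
    and 0: "\<And>z. z \<in> topspace Z - K \<Longrightarrow> f z = 0"
    using assms by (auto simp: compactly_supported_def)
  have "compact (f ` K)" using image_compactin[OF K f] by simp
  then obtain b where b: "b > 0" "\<And>z. z \<in> K \<Longrightarrow> cmod (f z) \<le> b"
    using compact_imp_bounded bounded_pos by (metis imageI)
  show thesis
    by (rule that[of b]) (use b 0 in \<open>fastforce+\<close>)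
qed

text \<open>Properness keeps a cutoff on the base compactly supported after it is pulled back to a
  flow; this later shows that the character induced on the flow is nonzero.\<close>

lemma compactly_supported_compose_proper:
  assumes "f \<in> compactly_supported X" "proper_map Y X p" "continuous_map Y X p"
  shows "(\<lambda>y. f (p y)) \<in> compactly_supported Y"
proof -
  obtain K where f: "continuous_map X euclidean f" and K: "compactin X K"
    and 0: "\<And>z. z \<in> topspace X - K \<Longrightarrow> f z = 0"
    using assms by (auto simp: compactly_supported_def)
  have "continuous_map Y euclidean (f \<circ> p)" using assms(3) f by (rule continuous_map_compose)
  moreover have "compactin Y {y \<in> topspace Y. p y \<in> K}"
    using assms(2) K by (rule compactin_proper_map_preimage)
  moreover have "f (p y) = 0" if "y \<in> topspace Y - {y \<in> topspace Y. p y \<in> K}" for y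
    using that 0[of "p y"] assms(3) by (auto simp: continuous_map_def)
  ultimately show ?thesis unfolding compactly_supported_def o_def by blast
qed

lemma proper_map_locally_compact_domain:
  assumes "proper_map Y X p" "continuous_map Y X p" "locally_compact_space X"
  shows "locally_compact_space Y"
  unfolding locally_compact_space_def
proof
  fix y assume y: "y \<in> topspace Y"
  then have "p y \<in> topspace X" using assms(2) by (auto simp: continuous_map_def)
  then obtain U K where "openin X U" "compactin X K" "p y \<in> U" "U \<subseteq> K"
    using assms(3) unfolding locally_compact_space_def by blast
  then show "\<exists>U K. openin Y U \<and> compactin Y K \<and> y \<in> U \<and> U \<subseteq> K"
    using compactin_proper_map_preimage[OF assms(1)] openin_continuous_map_preimage[OF assms(2)] y
    by (intro exI[of _ "{y \<in> topspace Y. p y \<in> U}"] exI[of _ "{y \<in> topspace Y. p y \<in> K}"]) auto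
qed

lemma proper_map_cong:
  assumes f: "proper_map Y Z f" and eq: "\<And>y. y \<in> topspace Y \<Longrightarrow> f y = f' y"
  shows "proper_map Y Z f'"
proof -
  have "f' ` C = f ` C" if "closedin Y C" for C
    using closedin_subset[OF that] eq by (intro image_cong) auto
  moreover have "{y \<in> topspace Y. f' y = z} = {y \<in> topspace Y. f y = z}" for z
    using eq by auto
  ultimately show ?thesis using f by (simp add: proper_map_def closed_map_def)
qed

lemma proper_map_closedin_domain:
  assumes f: "proper_map Y Z f" and N: "closedin Y N"
  shows "proper_map (subtopology Y N) Z f"
proof -
  have "proper_map (subtopology Y N) Y id"
    using N closed_Int_compactin[OF N] by (simp add: proper_map_inclusion closedin_subset)
  from proper_map_compose[OF this f] show ?thesis by simp
qed

lemma openin_subtopology_topspace: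
  "openin (subtopology Y A) W \<Longrightarrow> \<exists>W'. openin Y W' \<and> W = W' \<inter> topspace (subtopology Y A)"
  using openin_subset by (fastforce simp: openin_subtopology)

lemma continuous_map_complex_mult:
  fixes f g :: "'b \<Rightarrow> complex"
  assumes "continuous_map Y euclidean f" "continuous_map Y euclidean g"
  shows "continuous_map Y euclidean (\<lambda>y. f y * g y)"
  using assms by (simp add: continuous_map_atin limitin_canonical_iff tendsto_mult)


section \<open>Groupoid actions\<close>

lemma right_action_in:
  assumes "right_action \<G> Y \<rho> \<alpha>" "y \<in> topspace Y" "g \<in> topspace (arrs \<G>)" "src \<G> g = \<rho> y"
  shows "\<alpha> y g \<in> topspace Y"
proof -
  have "continuous_map (subtopology (prod_topology Y (arrs \<G>)) {(y, g). src \<G> g = \<rho> y}) Y (\<lambda>(y, g). \<alpha> y g)"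
    using assms(1) by (simp add: right_action_def)
  from continuous_map_image_subset_topspace[OF this] show ?thesis
    using assms(2-4) by auto
qed

lemma right_action_anchor:
  assumes "right_action \<G> Y \<rho> \<alpha>" "y \<in> topspace Y" "g \<in> topspace (arrs \<G>)" "src \<G> g = \<rho> y"
  shows "\<rho> (\<alpha> y g) = tgt \<G> g"
  using assms by (simp add: right_action_def)

lemma right_action_cmp:
  assumes "right_action \<G> Y \<rho> \<alpha>" "y \<in> topspace Y" "h \<in> topspace (arrs \<G>)" "g \<in> topspace (arrs \<G>)"
    "src \<G> h = \<rho> y" "tgt \<G> h = src \<G> g"
  shows "\<alpha> (\<alpha> y h) g = \<alpha> y (cmp \<G> h g)"
  using assms by (simp add: right_action_def)

lemma right_action_continuous:
  assumes act: "right_action \<G> Y \<rho> \<alpha>"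
    and y: "continuous_map Z Y y" and c: "continuous_map Z (arrs \<G>) c"
    and src: "\<And>z. z \<in> topspace Z \<Longrightarrow> src \<G> (c z) = \<rho> (y z)"
  shows "continuous_map Z Y (\<lambda>z. \<alpha> (y z) (c z))"
proof -
  have 1: "continuous_map Z (subtopology (prod_topology Y (arrs \<G>)) {(y, g). src \<G> g = \<rho> y})
      (\<lambda>z. (y z, c z))"
    unfolding continuous_map_in_subtopology using continuous_map_pairedI[OF y c] src by auto
  have 2: "continuous_map (subtopology (prod_topology Y (arrs \<G>)) {(y, g). src \<G> g = \<rho> y}) Y
      (\<lambda>(y, g). \<alpha> y g)"
    using act by (simp add: right_action_def)
  show ?thesis using continuous_map_compose[OF 1 2] by (simp add: o_def)
qed

lemma right_action_subtopology:
  assumes act: "right_action \<G> Y \<rho> \<alpha>" and inv: "\<And>y. y \<in> N \<Longrightarrow> orbit \<G> \<rho> \<alpha> y \<subseteq> N"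
  shows "right_action \<G> (subtopology Y N) \<rho> \<alpha>"
proof -
  let ?Z = "subtopology (prod_topology (subtopology Y N) (arrs \<G>)) {(y, g). src \<G> g = \<rho> y}"
  have y: "continuous_map ?Z Y fst"
    using continuous_map_fst[of "subtopology Y N" "arrs \<G>"] continuous_map_into_fulltopology
      continuous_map_from_subtopology by blast
  have g: "continuous_map ?Z (arrs \<G>) snd"
    by (intro continuous_map_from_subtopology continuous_map_snd)
  have "continuous_map ?Z Y (\<lambda>z. \<alpha> (fst z) (snd z))"
    by (rule right_action_continuous[OF act y g]) auto
  moreover have "\<alpha> (fst z) (snd z) \<in> N" if "z \<in> topspace ?Z" for z
  proof -
    have "\<alpha> (fst z) (snd z) \<in> orbit \<G> \<rho> \<alpha> (fst z)" "fst z \<in> N"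
      using that by (auto simp: orbit_def)
    then show ?thesis using inv by blast
  qed
  ultimately have "continuous_map ?Z (subtopology Y N) (\<lambda>(y, g). \<alpha> y g)"
    by (simp add: continuous_map_in_subtopology case_prod_beta' image_subset_iff)
  moreover have "continuous_map (subtopology Y N) (objs \<G>) \<rho>"
    using act by (simp add: right_action_def continuous_map_from_subtopology)
  ultimately show ?thesis
    using act by (simp add: right_action_def)
qed

text \<open>The arrow \<open>c t0\<close> is a unit, so the difference vanishes on the slice over
  \<open>t0\<close>; as the fibre is compact, the tube lemma widens the slice. The parameter space
  is left free: it is the structure group when the arrows stay over one point, and a piece of the
  base when they leave along a section.\<close>

lemma right_action_uniform_near_unit:
  fixes f :: "'y \<Rightarrow> complex"
  assumes act: "right_action \<G> Y \<rho> \<alpha>"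
    and cpt: "compactin Y {y \<in> topspace Y. \<rho> y = x}"
    and c: "continuous_map T (arrs \<G>) c" and src: "\<And>t. t \<in> topspace T \<Longrightarrow> src \<G> (c t) = x"
    and t0: "t0 \<in> topspace T" "c t0 = idt \<G> x"
    and f: "continuous_map Y euclidean f" and \<epsilon>: "\<epsilon> > 0"
  obtains N where "openin T N" "t0 \<in> N"
    "\<And>t y. \<lbrakk>t \<in> N; y \<in> topspace Y; \<rho> y = x\<rbrakk> \<Longrightarrow> cmod (f (\<alpha> y (c t)) - f y) < \<epsilon>"
proof -
  define C where "C = {y \<in> topspace Y. \<rho> y = x}"
  let ?Z = "prod_topology (subtopology Y C) T"
  have topC: "topspace (subtopology Y C) = C" by (auto simp: C_def)
  have 1: "continuous_map ?Z Y fst"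
    using continuous_map_fst continuous_map_into_fulltopology by blast
  have 2: "continuous_map ?Z (arrs \<G>) (\<lambda>z. c (snd z))"
    using continuous_map_compose[OF continuous_map_snd c] by (simp add: o_def)
  have 3: "continuous_map ?Z (subtopology (prod_topology Y (arrs \<G>)) {(y, g). src \<G> g = \<rho> y})
      (\<lambda>z. (fst z, c (snd z)))"
    unfolding continuous_map_in_subtopology using continuous_map_pairedI[OF 1 2] src
    by (auto simp: C_def)
  have 4: "continuous_map (subtopology (prod_topology Y (arrs \<G>)) {(y, g). src \<G> g = \<rho> y}) Y
      (\<lambda>(y, g). \<alpha> y g)"
    using act by (simp add: right_action_def)
  have 5: "continuous_map ?Z Y (\<lambda>z. \<alpha> (fst z) (c (snd z)))"
    using continuous_map_compose[OF 3 4] by (simp add: o_def)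
  have 6: "continuous_map ?Z euclidean (\<lambda>z. f (\<alpha> (fst z) (c (snd z))))"
    using continuous_map_compose[OF 5 f] by (simp add: o_def)
  have 7: "continuous_map ?Z euclidean (\<lambda>z. f (fst z))"
    using continuous_map_compose[OF 1 f] by (simp add: o_def)
  have 8: "continuous_map ?Z euclidean (\<lambda>z. cmod (f (\<alpha> (fst z) (c (snd z))) - f (fst z)))"
    by (intro continuous_map_norm continuous_map_diff 6 7)
  let ?W = "{z \<in> topspace ?Z. cmod (f (\<alpha> (fst z) (c (snd z))) - f (fst z)) \<in> {..<\<epsilon>}}"
  have W: "openin ?Z ?W" by (rule openin_continuous_map_preimage[OF 8]) auto
  have cC: "compactin (subtopology Y C) C" using cpt by (simp add: compactin_subtopology C_def)
  have "C \<times> {t0} \<subseteq> ?W"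
    using t0 \<epsilon> act by (auto simp: C_def right_action_def)
  from tube_lemma_left[OF W cC t0(1) this] obtain U N where
    "openin T N" "C \<subseteq> U" "t0 \<in> N" "U \<times> N \<subseteq> ?W" by blast
  moreover have "cmod (f (\<alpha> y (c t)) - f y) < \<epsilon>" if "t \<in> N" "y \<in> topspace Y" "\<rho> y = x" for t y
  proof -
    have "(y, t) \<in> ?W"
      using that \<open>C \<subseteq> U\<close> by (intro subsetD[OF \<open>U \<times> N \<subseteq> ?W\<close>]) (auto simp: C_def)
    then show ?thesis by simp
  qed
  ultimately show thesis using that by blast
qed

section \<open>Principal bundles\<close>

locale principal_bundle_at =
  fixes B :: "('g, 'p, 'x) bundle_data" and u0 :: 'p
  assumes principal: "principal_bundle B"
    and base_lc: "locally_compact_space (base_space B)"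
    and u0: "u0 \<in> topspace (tot_space B)"
begin

abbreviation "P \<equiv> tot_space B"
abbreviation "X \<equiv> base_space B"
abbreviation "T \<equiv> grp_top B"
abbreviation "\<G> \<equiv> gauge_groupoid B"
abbreviation "x0 \<equiv> proj B u0"
abbreviation "F \<equiv> source_fibre \<G> x0"
abbreviation "R \<equiv> R_alg B u0"
abbreviation "S \<equiv> S_space B u0"
abbreviation act (infixl "\<star>" 70) where "v \<star> g \<equiv> ract B v g"
abbreviation mlt (infixl "\<odot>" 70) where "g \<odot> h \<equiv> g \<otimes>\<^bsub>grp B\<^esub> h"
abbreviation "G \<equiv> carrier (grp B)"
abbreviation "inver g \<equiv> inv\<^bsub>grp B\<^esub> g"
abbreviation "unit \<equiv> \<one>\<^bsub>grp B\<^esub>"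
abbreviation "arr \<equiv> diag_orbit B"

lemma grp: "group (grp B)"
  and topspace_T [simp]: "topspace T = G"
  and cont_mult: "continuous_map (prod_topology T T) T (\<lambda>(g, h). g \<odot> h)"
  and cont_inv: "continuous_map T T (\<lambda>g. inver g)"
  using principal by (auto simp: principal_bundle_def topological_group_def)

sublocale group "grp B" by (rule grp)

lemma base_T2: "Hausdorff_space X"
  and cont_act: "continuous_map (prod_topology P T) P (\<lambda>(v, g). v \<star> g)"
  and cont_proj: "continuous_map P X (proj B)"
  and proj_surj: "proj B ` topspace P = topspace X"
  using principal quotient_imp_continuous_map[of P X "proj B"] quotient_imp_surjective_map[of P X "proj B"]
  by (simp_all add: principal_bundle_def)

lemma act_closed [simp]: "\<lbrakk>v \<in> topspace P; g \<in> G\<rbrakk> \<Longrightarrow> v \<star> g \<in> topspace P"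
  using continuous_map_image_subset_topspace[OF cont_act] by auto

lemma act_one [simp]: "v \<in> topspace P \<Longrightarrow> v \<star> unit = v"
  and act_act [simp]: "\<lbrakk>v \<in> topspace P; g \<in> G; h \<in> G\<rbrakk> \<Longrightarrow> v \<star> g \<star> h = v \<star> (g \<odot> h)"
  and proj_act [simp]: "\<lbrakk>v \<in> topspace P; g \<in> G\<rbrakk> \<Longrightarrow> proj B (v \<star> g) = proj B v"
  and act_ex1: "\<lbrakk>v \<in> topspace P; w \<in> topspace P; proj B v = proj B w\<rbrakk> \<Longrightarrow> \<exists>!g. g \<in> G \<and> v \<star> g = w"
  using principal by (auto simp: principal_bundle_def)

lemma act_cancel: "\<lbrakk>v \<in> topspace P; g \<in> G; h \<in> G; v \<star> g = v \<star> h\<rbrakk> \<Longrightarrow> g = h"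
  using act_ex1[of v "v \<star> g"] by (metis act_closed proj_act)

lemma proj_in [simp]: "v \<in> topspace P \<Longrightarrow> proj B v \<in> topspace X"
  using proj_surj by blast

lemma objs_gauge [simp]: "objs \<G> = X"
  by (simp add: gauge_groupoid_def)

text \<open>The section is the preimage of \<open>(y, unit)\<close> under the chart and
  \<open>\<kappa>\<close> is the group coordinate. This form matches the definition of
  \<open>R\<close>, which speaks of sections, and the last clause makes \<open>k\<close> the
  coordinate of \<open>\<sigma> y \<star> k\<close>.\<close>

lemma local_trivialization:
  assumes x: "x \<in> topspace X"
  obtains U \<sigma> \<kappa> where "openin X U" "x \<in> U"
    "continuous_map (subtopology X U) P \<sigma>" "\<And>y. y \<in> U \<Longrightarrow> proj B (\<sigma> y) = y"
    "continuous_map (subtopology P {v \<in> topspace P. proj B v \<in> U}) T \<kappa>"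
    "\<And>v. \<lbrakk>v \<in> topspace P; proj B v \<in> U\<rbrakk> \<Longrightarrow> v = \<sigma> (proj B v) \<star> \<kappa> v"
    "\<And>v g. \<lbrakk>v \<in> topspace P; proj B v \<in> U; g \<in> G\<rbrakk> \<Longrightarrow> \<kappa> (v \<star> g) = \<kappa> v \<odot> g"
    "\<And>y. y \<in> U \<Longrightarrow> \<kappa> (\<sigma> y) = unit"
proof -
  let ?PU = "\<lambda>U. subtopology P {v \<in> topspace P. proj B v \<in> U}"
  have "\<exists>U \<phi>. openin X U \<and> x \<in> U \<and>
        homeomorphic_map (?PU U) (prod_topology (subtopology X U) T) \<phi> \<and>
        (\<forall>v \<in> topspace P. proj B v \<in> U \<longrightarrow>
           fst (\<phi> v) = proj B v \<and> (\<forall>g \<in> G. \<phi> (v \<star> g) = (proj B v, snd (\<phi> v) \<odot> g)))"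
    using principal x unfolding principal_bundle_def by blast
  then obtain U \<phi> where U: "openin X U" "x \<in> U"
    and hom: "homeomorphic_map (?PU U) (prod_topology (subtopology X U) T) \<phi>"
    and fst_\<phi>: "\<And>v. \<lbrakk>v \<in> topspace P; proj B v \<in> U\<rbrakk> \<Longrightarrow> fst (\<phi> v) = proj B v"
    and \<phi>_act: "\<And>v g. \<lbrakk>v \<in> topspace P; proj B v \<in> U; g \<in> G\<rbrakk> \<Longrightarrow> \<phi> (v \<star> g) = (proj B v, snd (\<phi> v) \<odot> g)"
    by blast
  obtain \<psi> where "homeomorphic_maps (?PU U) (prod_topology (subtopology X U) T) \<phi> \<psi>"
    using hom homeomorphic_map_maps by blast
  then have c\<phi>: "continuous_map (?PU U) (prod_topology (subtopology X U) T) \<phi>"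
    and c\<psi>: "continuous_map (prod_topology (subtopology X U) T) (?PU U) \<psi>"
    and \<psi>\<phi>: "\<And>v. \<lbrakk>v \<in> topspace P; proj B v \<in> U\<rbrakk> \<Longrightarrow> \<psi> (\<phi> v) = v"
    and \<phi>\<psi>: "\<And>y g. \<lbrakk>y \<in> U; g \<in> G\<rbrakk> \<Longrightarrow> \<phi> (\<psi> (y, g)) = (y, g)"
    using openin_subset[OF U(1)] by (auto simp: homeomorphic_maps_def)
  define \<sigma> where "\<sigma> y = \<psi> (y, unit)" for y
  define \<kappa> where "\<kappa> v = snd (\<phi> v)" for v
  have "continuous_map (subtopology X U) (?PU U) (\<psi> \<circ> (\<lambda>y. (y, unit)))"
    by (rule continuous_map_compose[OF _ c\<psi>]) (auto intro!: continuous_map_pairedI)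
  then have c\<sigma>: "continuous_map (subtopology X U) (?PU U) \<sigma>"
    by (simp add: o_def \<sigma>_def[abs_def])
  then have \<sigma>_in: "\<sigma> y \<in> topspace P" "proj B (\<sigma> y) \<in> U" if "y \<in> U" for y
    using that openin_subset[OF U(1)] by (auto simp: continuous_map_def Pi_iff)
  have \<phi>\<sigma>: "\<phi> (\<sigma> y) = (y, unit)" if "y \<in> U" for y
    using that by (simp add: \<sigma>_def \<phi>\<psi>)
  have proj_\<sigma>: "proj B (\<sigma> y) = y" if "y \<in> U" for y
    using fst_\<phi>[OF \<sigma>_in[OF that]] \<phi>\<sigma>[OF that] by simp
  have "continuous_map (?PU U) T (snd \<circ> \<phi>)"
    by (rule continuous_map_compose[OF c\<phi> continuous_map_snd])
  then have c\<kappa>: "continuous_map (?PU U) T \<kappa>" by (simp add: o_def \<kappa>_def[abs_def])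
  then have \<kappa>_in: "\<kappa> v \<in> G" if "v \<in> topspace P" "proj B v \<in> U" for v
    using that by (auto simp: continuous_map_def Pi_iff)
  have dec: "v = \<sigma> (proj B v) \<star> \<kappa> v" if "v \<in> topspace P" "proj B v \<in> U" for v
  proof -
    have "\<phi> (\<sigma> (proj B v) \<star> \<kappa> v) = (proj B v, \<kappa> v)"
      using that by (simp add: \<phi>_act \<sigma>_in proj_\<sigma> \<phi>\<sigma> \<kappa>_in)
    also have "\<dots> = \<phi> v" using fst_\<phi>[OF that] by (simp add: \<kappa>_def prod_eq_iff)
    finally show ?thesis
      using \<psi>\<phi>[of v] \<psi>\<phi>[of "\<sigma> (proj B v) \<star> \<kappa> v"] that by (simp add: \<sigma>_in proj_\<sigma> \<kappa>_in)
  qed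
  show thesis
  proof (rule that[OF U _ proj_\<sigma> c\<kappa> dec])
    show "continuous_map (subtopology X U) P \<sigma>"
      using c\<sigma> continuous_map_into_fulltopology by blast
  qed (auto simp: \<kappa>_def \<phi>_act \<phi>\<sigma>)
qed


subsection \<open>Arrows of the gauge groupoid\<close>

lemma arr_act [simp]:
  assumes "v \<in> topspace P" "w \<in> topspace P" "g \<in> G"
  shows "arr (v \<star> g) (w \<star> g) = arr v w"
proof -
  have "arr (v \<star> g) (w \<star> g) \<subseteq> arr v w" if "v \<in> topspace P" "w \<in> topspace P" "g \<in> G" for v w g
    using that by (auto simp: diag_orbit_def)
  from this[OF assms] this[of "v \<star> g" "w \<star> g" "inver g"] show ?thesis
    using assms by auto
qed

lemma src_arr [simp]: "\<lbrakk>v \<in> topspace P; w \<in> topspace P\<rbrakk> \<Longrightarrow> src \<G> (arr v w) = proj B v"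
  and tgt_arr [simp]: "\<lbrakk>v \<in> topspace P; w \<in> topspace P\<rbrakk> \<Longrightarrow> tgt \<G> (arr v w) = proj B w"
  and cmp_arr [simp]: "\<lbrakk>u \<in> topspace P; v \<in> topspace P; w \<in> topspace P\<rbrakk> \<Longrightarrow> cmp \<G> (arr u v) (arr v w) = arr u w"
  and idt_proj: "v \<in> topspace P \<Longrightarrow> idt \<G> (proj B v) = arr v v"
  using gauge_groupoid_orbits[OF principal] by auto

lemma topspace_arrs: "topspace (arrs \<G>) = {arr v w | v w. v \<in> topspace P \<and> w \<in> topspace P}"
  by (auto simp: gauge_groupoid_def topspace_quotient_topology)

lemma arr_in [simp]: "\<lbrakk>v \<in> topspace P; w \<in> topspace P\<rbrakk> \<Longrightarrow> arr v w \<in> topspace (arrs \<G>)"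
  by (auto simp: topspace_arrs)

lemma arr_eqE:
  assumes "arr v w = arr v' w'" "v \<in> topspace P" "w \<in> topspace P" "v' \<in> topspace P" "w' \<in> topspace P"
  obtains g where "g \<in> G" "v' = v \<star> g" "w' = w \<star> g"
proof -
  have "(v', w') \<in> arr v' w'"
    using assms by (auto simp: diag_orbit_def intro!: exI[of _ unit])
  then show thesis using assms(1) that by (auto simp: diag_orbit_def)
qed

lemma quotient_arr: "quotient_map (prod_topology P P) (arrs \<G>) (\<lambda>(v, w). arr v w)"
  by (simp add: gauge_groupoid_def quotient_map_quotient_topology)

lemma cont_arr:
  assumes "continuous_map Z P f" "continuous_map Z P h"
  shows "continuous_map Z (arrs \<G>) (\<lambda>z. arr (f z) (h z))"
  using continuous_map_compose[OF continuous_map_pairedI[OF assms] quotient_imp_continuous_map[OF quotient_arr]]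
  by (simp add: o_def)

lemma cont_act_const:
  assumes "continuous_map Z P f" "continuous_map Z T h"
  shows "continuous_map Z P (\<lambda>z. f z \<star> h z)"
  using continuous_map_compose[OF continuous_map_pairedI[OF assms] cont_act] by (simp add: o_def)

lemma cont_mult_comp:
  assumes "continuous_map Z T f" "continuous_map Z T h"
  shows "continuous_map Z T (\<lambda>z. f z \<odot> h z)"
  using continuous_map_compose[OF continuous_map_pairedI[OF assms] cont_mult] by (simp add: o_def)

lemma cont_inv_comp:
  assumes "continuous_map Z T f"
  shows "continuous_map Z T (\<lambda>z. inver (f z))"
  using continuous_map_compose[OF assms cont_inv] by (simp add: o_def)

text \<open>The saturation of \<open>W\<close> is the union of its translates under the diagonal
  action, each of them open. Openness, unlike being a quotient map, survives restriction to the part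
  over the source fibre.\<close>

lemma open_map_arr: "open_map (prod_topology P P) (arrs \<G>) (\<lambda>(v, w). arr v w)"
  unfolding open_map_def
proof (intro allI impI)
  fix W assume W: "openin (prod_topology P P) W"
  let ?q = "\<lambda>(v, w). arr v w"
  let ?a = "\<lambda>g z. (fst z \<star> g, snd z \<star> g)"
  have sub: "W \<subseteq> topspace P \<times> topspace P" using openin_subset[OF W] by simp
  have "{z \<in> topspace (prod_topology P P). ?q z \<in> ?q ` W}
      = (\<Union>g\<in>G. {z \<in> topspace (prod_topology P P). ?a g z \<in> W})" (is "?A = ?C")
  proof
    show "?A \<subseteq> ?C"
    proof
      fix z assume "z \<in> ?A"
      then obtain v w v' w' where z: "z = (v, w)" "v \<in> topspace P" "w \<in> topspace P"
        and w: "(v', w') \<in> W" and eq: "arr v w = arr v' w'" by auto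
      then obtain g where "g \<in> G" "v' = v \<star> g" "w' = w \<star> g"
        using arr_eqE[OF eq] sub by auto
      then show "z \<in> ?C" using z w by auto
    qed
    show "?C \<subseteq> ?A"
    proof
      fix z assume "z \<in> ?C"
      then obtain v w g where z: "z = (v, w)" "v \<in> topspace P" "w \<in> topspace P"
        and w: "(v \<star> g, w \<star> g) \<in> W" and g: "g \<in> G" by auto
      have "?q z = ?q (v \<star> g, w \<star> g)" using z g by simp
      then have "?q z \<in> ?q ` W" using w by blast
      then show "z \<in> ?A" using z by simp
    qed
  qed
  moreover have "openin (prod_topology P P) {z \<in> topspace (prod_topology P P). ?a g z \<in> W}" if "g \<in> G" for g
    by (rule openin_continuous_map_preimage[OF _ W])
      (use that in \<open>auto intro!: continuous_map_pairedI cont_act_const continuous_map_fst continuous_map_snd\<close>)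
  ultimately have "openin (prod_topology P P) {z \<in> topspace (prod_topology P P). ?q z \<in> ?q ` W}"
    by auto
  moreover have "?q ` W \<subseteq> ?q ` topspace (prod_topology P P)" using openin_subset[OF W] by blast
  ultimately show "openin (arrs \<G>) (?q ` W)"
    by (simp add: gauge_groupoid_def openin_quotient_topology)
qed


subsection \<open>The source fibre\<close>

lemma topspace_F: "topspace F = arr u0 ` topspace P"
proof
  show "arr u0 ` topspace P \<subseteq> topspace F" using u0 by (auto simp: source_fibre_def)
  show "topspace F \<subseteq> arr u0 ` topspace P"
  proof
    fix \<tau> assume "\<tau> \<in> topspace F"
    then obtain v w where \<tau>: "\<tau> = arr v w" "v \<in> topspace P" "w \<in> topspace P" "proj B v = x0"
      by (auto simp: source_fibre_def topspace_arrs)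
    then obtain g where "g \<in> G" "v \<star> g = u0" using act_ex1[of v u0] u0 by auto
    then have "\<tau> = arr u0 (w \<star> g)" using arr_act[of v w g] \<tau> by simp
    then show "\<tau> \<in> arr u0 ` topspace P" using \<tau> \<open>g \<in> G\<close> by auto
  qed
qed

lemma arr_u0_in [simp]: "v \<in> topspace P \<Longrightarrow> arr u0 v \<in> topspace F"
  by (simp add: topspace_F)

lemma arr_u0_inj: "\<lbrakk>v \<in> topspace P; w \<in> topspace P; arr u0 v = arr u0 w\<rbrakk> \<Longrightarrow> v = w"
  using arr_eqE[of u0 v u0 w] act_cancel[of u0 _ unit] u0 by (metis act_one one_closed)

lemma arr_act_u0:
  assumes "v \<in> topspace P" "h \<in> G"
  shows "arr (u0 \<star> h) v = arr u0 (v \<star> inver h)"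
  using arr_act[of "u0 \<star> h" v "inver h"] assms u0 by simp

definition "pt \<tau> = (THE v. v \<in> topspace P \<and> arr u0 v = \<tau>)"

lemma pt_arr [simp]: "v \<in> topspace P \<Longrightarrow> pt (arr u0 v) = v"
  unfolding pt_def by (rule the_equality) (simp, metis arr_u0_inj)

text \<open>The source fibre is a subspace of a quotient, so continuity is tested after the
  restricted orbit map, a quotient map because it is open. There
  \<open>[v, w] = [u0, w g^-1]\<close> with \<open>v = u0 g\<close>, and \<open>g\<close> is
  \<open>inver (\<kappa> u0) \<odot> \<kappa> v\<close> in a single chart around \<open>x0\<close>,
  hence continuous in \<open>v\<close>.\<close>

lemma cont_pt: "continuous_map F P pt"
proof -
  let ?Y = "{z \<in> topspace (prod_topology P P). proj B (fst z) = x0}"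
  let ?q = "\<lambda>(v, w). arr v w"
  have Y: "{z \<in> topspace (prod_topology P P). ?q z \<in> {a. src \<G> a = x0}} = ?Y" by auto
  have "open_map (subtopology (prod_topology P P) ?Y) F ?q"
    unfolding source_fibre_def by (rule open_map_restriction[OF open_map_arr Y])
  moreover have "continuous_map (subtopology (prod_topology P P) ?Y) F ?q"
    unfolding source_fibre_def continuous_map_in_subtopology
    using quotient_imp_continuous_map[OF quotient_arr] continuous_map_from_subtopology by auto
  moreover have "?q ` topspace (subtopology (prod_topology P P) ?Y) = topspace F"
  proof
    show "?q ` topspace (subtopology (prod_topology P P) ?Y) \<subseteq> topspace F"
      by (auto simp: source_fibre_def)
    show "topspace F \<subseteq> ?q ` topspace (subtopology (prod_topology P P) ?Y)"
      using u0 by (auto simp: topspace_F image_iff)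
  qed
  ultimately have quo: "quotient_map (subtopology (prod_topology P P) ?Y) F ?q"
    by (intro continuous_open_imp_quotient_map) auto
  obtain U \<sigma> \<kappa> where U: "openin X U" "x0 \<in> U"
    "continuous_map (subtopology X U) P \<sigma>" "\<And>y. y \<in> U \<Longrightarrow> proj B (\<sigma> y) = y"
    and c\<kappa>: "continuous_map (subtopology P {v \<in> topspace P. proj B v \<in> U}) T \<kappa>"
    and "\<And>v. \<lbrakk>v \<in> topspace P; proj B v \<in> U\<rbrakk> \<Longrightarrow> v = \<sigma> (proj B v) \<star> \<kappa> v"
    and \<kappa>_act: "\<And>v g. \<lbrakk>v \<in> topspace P; proj B v \<in> U; g \<in> G\<rbrakk> \<Longrightarrow> \<kappa> (v \<star> g) = \<kappa> v \<odot> g"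
    and "\<And>y. y \<in> U \<Longrightarrow> \<kappa> (\<sigma> y) = unit"
    by (rule local_trivialization[OF proj_in[OF u0]]) (rule that)
  have \<kappa>_in: "\<kappa> v \<in> G" if "v \<in> topspace P" "proj B v \<in> U" for v
    using c\<kappa> that by (auto simp: continuous_map_def Pi_iff)
  have c1: "continuous_map (subtopology (prod_topology P P) ?Y) (subtopology P {v \<in> topspace P. proj B v \<in> U}) fst"
    unfolding continuous_map_in_subtopology
    using U by (auto intro: continuous_map_from_subtopology continuous_map_fst)
  have c2: "continuous_map (subtopology (prod_topology P P) ?Y) P snd"
    by (auto intro: continuous_map_from_subtopology continuous_map_snd)
  have c3: "continuous_map (subtopology (prod_topology P P) ?Y) T (\<lambda>z. \<kappa> (fst z))"
    using continuous_map_compose[OF c1 c\<kappa>] by (simp add: o_def)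
  have "continuous_map (subtopology (prod_topology P P) ?Y) P
      (\<lambda>z. snd z \<star> inver (inver (\<kappa> u0) \<odot> \<kappa> (fst z)))"
    by (intro cont_act_const c2 cont_inv_comp cont_mult_comp c3) (use \<kappa>_in u0 U in auto)
  moreover have "snd z \<star> inver (inver (\<kappa> u0) \<odot> \<kappa> (fst z)) = (pt \<circ> ?q) z"
    if zY: "z \<in> topspace (subtopology (prod_topology P P) ?Y)" for z
  proof -
    obtain v w where z: "z = (v, w)" by (cases z)
    with zY have vw: "v \<in> topspace P" "w \<in> topspace P" "proj B v = x0" by auto
    with u0 obtain g where g: "g \<in> G" "v = u0 \<star> g" using act_ex1[of u0 v] by auto
    have \<kappa>u0: "\<kappa> u0 \<in> G" using \<kappa>_in[OF u0] U(2) by simp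
    have "\<kappa> v = \<kappa> u0 \<odot> g" unfolding g(2) by (rule \<kappa>_act[OF u0 U(2) g(1)])
    then have "inver (\<kappa> u0) \<odot> \<kappa> v = g"
      using m_assoc[of "inver (\<kappa> u0)" "\<kappa> u0" g] g(1) \<kappa>u0 by simp
    moreover have "arr v w = arr u0 (w \<star> inver g)"
      unfolding g(2) by (rule arr_act_u0[OF vw(2) g(1)])
    ultimately show ?thesis using vw g(1) by (simp add: z)
  qed
  ultimately have "continuous_map (subtopology (prod_topology P P) ?Y) P (pt \<circ> ?q)"
    by (rule continuous_map_eq)
  with quo show ?thesis by (rule continuous_compose_quotient_map)
qed

section \<open>The algebra of functions on the source fibre\<close>

lemma R_alg_iff:
  "f \<in> R \<longleftrightarrow> (\<forall>\<tau>. \<tau> \<notin> topspace F \<longrightarrow> f \<tau> = 0) \<and> bounded (f ` topspace F) \<and>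
     continuous_map F euclidean f \<and>
     (\<exists>K. compactin X K \<and> (\<forall>\<tau> \<in> topspace F. tgt \<G> \<tau> \<notin> K \<longrightarrow> f \<tau> = 0)) \<and>
     (\<forall>U \<sigma> \<epsilon>. openin X U \<and> continuous_map (subtopology X U) P \<sigma> \<and> (\<forall>x \<in> U. proj B (\<sigma> x) = x) \<and> \<epsilon> > 0 \<longrightarrow>
        (\<exists>V. openin T V \<and> unit \<in> V \<and>
           (\<forall>g \<in> V. \<forall>h \<in> G. \<forall>x \<in> U.
              cmod (f (arr (u0 \<star> (g \<odot> h)) (\<sigma> x)) - f (arr (u0 \<star> h) (\<sigma> x))) < \<epsilon>)))"
  by (simp add: R_alg_def Let_def)

text \<open>Since \<open>[u0 g h, x'] = [u0, x' h^-1 g^-1]\<close>, the defining condition compares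
  the values at \<open>v = x' h^-1\<close> and \<open>v g^-1\<close>. A bound uniform over
  \<open>P\<close> therefore serves every local section at once, after inversion of the
  neighbourhood.\<close>

lemma R_algI:
  assumes zero: "\<And>\<tau>. \<tau> \<notin> topspace F \<Longrightarrow> f \<tau> = 0"
    and bdd: "\<And>v. v \<in> topspace P \<Longrightarrow> cmod (f (arr u0 v)) \<le> b"
    and cont: "continuous_map F euclidean f"
    and K: "compactin X K" "\<And>v. \<lbrakk>v \<in> topspace P; proj B v \<notin> K\<rbrakk> \<Longrightarrow> f (arr u0 v) = 0"
    and unif: "\<And>\<epsilon>. \<epsilon> > 0 \<Longrightarrow> \<exists>V. openin T V \<and> unit \<in> V \<and>
        (\<forall>g\<in>V. \<forall>v\<in>topspace P. cmod (f (arr u0 (v \<star> g)) - f (arr u0 v)) < \<epsilon>)"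
  shows "f \<in> R"
  unfolding R_alg_iff
proof (intro conjI allI impI; (elim conjE)?)
  show "bounded (f ` topspace F)"
    using bdd by (auto simp: topspace_F bounded_iff)
  show "\<exists>K. compactin X K \<and> (\<forall>\<tau> \<in> topspace F. tgt \<G> \<tau> \<notin> K \<longrightarrow> f \<tau> = 0)"
    using K u0 by (intro exI[of _ K]) (simp add: topspace_F)
  fix U \<sigma> \<epsilon>
  assume U: "openin X U" "continuous_map (subtopology X U) P \<sigma>" and \<epsilon>: "(\<epsilon>::real) > 0"
  have \<sigma>: "\<sigma> x \<in> topspace P" if "x \<in> U" for x
    using U that openin_subset[OF U(1)] by (auto simp: continuous_map_def Pi_iff)
  obtain V where V: "openin T V" "unit \<in> V"
    "\<forall>g\<in>V. \<forall>v\<in>topspace P. cmod (f (arr u0 (v \<star> g)) - f (arr u0 v)) < \<epsilon>"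
    using unif[OF \<epsilon>] by blast
  let ?V = "{g \<in> topspace T. inver g \<in> V}"
  have "openin T ?V" by (rule openin_continuous_map_preimage[OF cont_inv V(1)])
  moreover have "unit \<in> ?V" using V(2) by simp
  moreover have "cmod (f (arr (u0 \<star> (g \<odot> h)) (\<sigma> x)) - f (arr (u0 \<star> h) (\<sigma> x))) < \<epsilon>"
    if ghx: "g \<in> ?V" "h \<in> G" "x \<in> U" for g h x
  proof -
    have g: "g \<in> G" "inver g \<in> V" using ghx by auto
    have "arr (u0 \<star> (g \<odot> h)) (\<sigma> x) = arr u0 (\<sigma> x \<star> inver h \<star> inver g)"
      "arr (u0 \<star> h) (\<sigma> x) = arr u0 (\<sigma> x \<star> inver h)"
      using ghx(2) g(1) \<sigma>[OF ghx(3)] by (simp_all add: arr_act_u0 inv_mult_group)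
    moreover have "\<sigma> x \<star> inver h \<in> topspace P" using ghx(2) \<sigma>[OF ghx(3)] by simp
    ultimately show ?thesis using V(3) g(2) by simp
  qed
  ultimately show "\<exists>V. openin T V \<and> unit \<in> V \<and> (\<forall>g \<in> V. \<forall>h \<in> G. \<forall>x \<in> U.
      cmod (f (arr (u0 \<star> (g \<odot> h)) (\<sigma> x)) - f (arr (u0 \<star> h) (\<sigma> x))) < \<epsilon>)"
    by blast
qed (use zero cont in auto)

lemma R_alg_bounded:
  assumes "f \<in> R"
  obtains b where "b > 0" "\<forall>\<tau>. cmod (f \<tau>) \<le> b"
proof -
  have "bounded (f ` topspace F)" and z: "\<forall>\<tau>. \<tau> \<notin> topspace F \<longrightarrow> f \<tau> = 0"
    using assms by (auto simp: R_alg_iff)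
  then obtain b where b: "b > 0" "\<forall>\<tau>\<in>topspace F. cmod (f \<tau>) \<le> b"
    by (auto simp: bounded_pos)
  have "cmod (f \<tau>) \<le> b" for \<tau>
    using b z by (cases "\<tau> \<in> topspace F") auto
  with b(1) show thesis using that by blast
qed

lemma R_alg_uniform:
  assumes "f \<in> R" "openin X U" "continuous_map (subtopology X U) P \<sigma>" "\<forall>x \<in> U. proj B (\<sigma> x) = x"
    "\<epsilon> > 0"
  shows "\<exists>V. openin T V \<and> unit \<in> V \<and> (\<forall>g \<in> V. \<forall>h \<in> G. \<forall>x \<in> U.
     cmod (f (arr (u0 \<star> (g \<odot> h)) (\<sigma> x)) - f (arr (u0 \<star> h) (\<sigma> x))) < \<epsilon>)"
  using assms by (simp add: R_alg_iff)

text \<open>The pair of bounded functions has values in a compact product of discs, on which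
  \<open>h\<close> is bounded and uniformly continuous. The normalisation
  \<open>h (0, 0) = 0\<close> preserves the extension by zero and the compact support. The algebra
  operations, conjugation and a cut-off division are all instances.\<close>

lemma R_alg_combine:
  assumes f: "f1 \<in> R" "f2 \<in> R" and h: "continuous_on UNIV h" "h (0, 0) = (0::complex)"
  shows "(\<lambda>\<tau>. h (f1 \<tau>, f2 \<tau>)) \<in> R"
proof -
  obtain b1 where b1: "b1 > 0" "\<forall>\<tau>. cmod (f1 \<tau>) \<le> b1" using R_alg_bounded[OF f(1)] by blast
  obtain b2 where b2: "b2 > 0" "\<forall>\<tau>. cmod (f2 \<tau>) \<le> b2" using R_alg_bounded[OF f(2)] by blast
  let ?C = "cball (0::complex) b1 \<times> cball (0::complex) b2"
  have C: "compact ?C" by (intro compact_Times compact_cball)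
  have hC: "continuous_on ?C h" using h(1) by (rule continuous_on_subset) simp
  have in_C: "(f1 \<tau>, f2 \<tau>) \<in> ?C" for \<tau> using b1 b2 by simp
  have 1: "bounded ((\<lambda>\<tau>. h (f1 \<tau>, f2 \<tau>)) ` topspace F)"
    by (rule bounded_subset[OF compact_imp_bounded[OF compact_continuous_image[OF hC C]]])
      (use in_C in blast)
  have "continuous_map F (prod_topology euclidean euclidean) (\<lambda>\<tau>. (f1 \<tau>, f2 \<tau>))"
    using f by (intro continuous_map_pairedI) (simp_all add: R_alg_iff)
  then have "continuous_map F euclidean (\<lambda>\<tau>. (f1 \<tau>, f2 \<tau>))"
    by (simp add: euclidean_product_topology)
  then have 2: "continuous_map F euclidean (\<lambda>\<tau>. h (f1 \<tau>, f2 \<tau>))"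
    using continuous_map_compose[of F euclidean "\<lambda>\<tau>. (f1 \<tau>, f2 \<tau>)" euclidean h] h(1)
    by (simp add: o_def)
  obtain K1 where K1: "compactin X K1" "\<forall>\<tau> \<in> topspace F. tgt \<G> \<tau> \<notin> K1 \<longrightarrow> f1 \<tau> = 0"
    using f(1) by (auto simp: R_alg_iff)
  obtain K2 where K2: "compactin X K2" "\<forall>\<tau> \<in> topspace F. tgt \<G> \<tau> \<notin> K2 \<longrightarrow> f2 \<tau> = 0"
    using f(2) by (auto simp: R_alg_iff)
  have 3: "compactin X (K1 \<union> K2)"
    "\<forall>\<tau> \<in> topspace F. tgt \<G> \<tau> \<notin> K1 \<union> K2 \<longrightarrow> h (f1 \<tau>, f2 \<tau>) = 0"
    using h(2) K1 K2 by (auto intro: compactin_Un)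
  have 4: "\<exists>V. openin T V \<and> unit \<in> V \<and> (\<forall>g \<in> V. \<forall>k \<in> G. \<forall>x \<in> U.
      cmod (h (f1 (arr (u0 \<star> (g \<odot> k)) (\<sigma> x)), f2 (arr (u0 \<star> (g \<odot> k)) (\<sigma> x)))
        - h (f1 (arr (u0 \<star> k) (\<sigma> x)), f2 (arr (u0 \<star> k) (\<sigma> x)))) < \<epsilon>)"
    if U: "openin X U" "continuous_map (subtopology X U) P \<sigma>" "\<forall>x \<in> U. proj B (\<sigma> x) = x" "\<epsilon> > 0"
    for U \<sigma> and \<epsilon> :: real
  proof -
    have "uniformly_continuous_on ?C h" using hC C by (rule compact_uniformly_continuous)
    then obtain d where d: "d > 0" "\<forall>p\<in>?C. \<forall>q\<in>?C. dist q p < d \<longrightarrow> dist (h q) (h p) < \<epsilon>"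
      using U(4) unfolding uniformly_continuous_on_def by meson
    \<comment> \<open>Half of \<open>d\<close> for each coordinate, because the distance in the
      product is at most the sum of the two distances.\<close>
    have d2: "d / 2 > 0" using d(1) by simp
    obtain V1 where V1: "openin T V1" "unit \<in> V1" "\<forall>g \<in> V1. \<forall>h \<in> G. \<forall>x \<in> U.
         cmod (f1 (arr (u0 \<star> (g \<odot> h)) (\<sigma> x)) - f1 (arr (u0 \<star> h) (\<sigma> x))) < d / 2"
      using R_alg_uniform[OF f(1) U(1-3) d2] by blast
    obtain V2 where V2: "openin T V2" "unit \<in> V2" "\<forall>g \<in> V2. \<forall>h \<in> G. \<forall>x \<in> U.
         cmod (f2 (arr (u0 \<star> (g \<odot> h)) (\<sigma> x)) - f2 (arr (u0 \<star> h) (\<sigma> x))) < d / 2"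
      using R_alg_uniform[OF f(2) U(1-3) d2] by blast
    have "cmod (h (f1 \<tau>, f2 \<tau>) - h (f1 \<tau>', f2 \<tau>')) < \<epsilon>"
      if "cmod (f1 \<tau> - f1 \<tau>') < d / 2" "cmod (f2 \<tau> - f2 \<tau>') < d / 2" for \<tau> \<tau>'
    proof -
      have "dist (f1 \<tau>, f2 \<tau>) (f1 \<tau>', f2 \<tau>') \<le> dist (f1 \<tau>) (f1 \<tau>') + dist (f2 \<tau>) (f2 \<tau>')"
        unfolding dist_Pair_Pair by (rule sqrt_sum_squares_le_sum) auto
      also have "\<dots> < d" using that by (simp add: dist_norm)
      finally have "dist (h (f1 \<tau>, f2 \<tau>)) (h (f1 \<tau>', f2 \<tau>')) < \<epsilon>"
        using d(2) in_C by blast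
      then show ?thesis by (simp add: dist_norm)
    qed
    then show ?thesis
      using V1 V2 by (intro exI[of _ "V1 \<inter> V2"] conjI) auto
  qed
  have 0: "\<forall>\<tau>. \<tau> \<notin> topspace F \<longrightarrow> h (f1 \<tau>, f2 \<tau>) = 0" using f h(2) by (simp add: R_alg_iff)
  show ?thesis
    unfolding R_alg_iff by (intro conjI 0 1 2 exI[of _ "K1 \<union> K2"] 3) (use 4 in blast)
qed

section \<open>Closure properties of the algebra\<close>

lemma R_alg_add: "\<lbrakk>f \<in> R; g \<in> R\<rbrakk> \<Longrightarrow> (\<lambda>\<tau>. f \<tau> + g \<tau>) \<in> R"
  using R_alg_combine[of f g "\<lambda>p. fst p + snd p"] by (simp add: continuous_intros)

lemma R_alg_mult: "\<lbrakk>f \<in> R; g \<in> R\<rbrakk> \<Longrightarrow> (\<lambda>\<tau>. f \<tau> * g \<tau>) \<in> R"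
  using R_alg_combine[of f g "\<lambda>p. fst p * snd p"] by (simp add: continuous_intros)

lemma R_alg_scale: "f \<in> R \<Longrightarrow> (\<lambda>\<tau>. c * f \<tau>) \<in> R"
  using R_alg_combine[of f f "\<lambda>p. c * fst p"] by (simp add: continuous_intros)

lemma R_alg_cnj: "f \<in> R \<Longrightarrow> (\<lambda>\<tau>. cnj (f \<tau>)) \<in> R"
  using R_alg_combine[of f f "\<lambda>p. cnj (fst p)"] by (simp add: continuous_intros)

text \<open>The lower bound \<open>d\<close> keeps the denominator away from zero everywhere; where
  \<open>g\<close> is real and at least \<open>d\<close> this is the true quotient. It stands in for
  inverting \<open>g\<close> on the support of \<open>f\<close>.\<close>

lemma R_alg_divide_max:
  assumes "f \<in> R" "g \<in> R" "d > 0"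
  shows "(\<lambda>\<tau>. f \<tau> / complex_of_real (max d (Re (g \<tau>)))) \<in> R"
proof -
  have "complex_of_real (max d (Re (snd p))) \<noteq> 0" for p :: "complex \<times> complex"
    using assms(3) by (simp add: max_def)
  then have "continuous_on UNIV (\<lambda>p. fst p / complex_of_real (max d (Re (snd p))))"
    by (intro continuous_intros ballI)
  then show ?thesis
    using R_alg_combine[OF assms(1,2), of "\<lambda>p. fst p / complex_of_real (max d (Re (snd p)))"] by simp
qed

text \<open>Extended by zero because the elements of \<open>R\<close> are total functions. The uses
  are \<open>q = tgt \<G>\<close> (dual of the anchor map), \<open>q = \<beta> m0\<close> (orbit map
  into a flow) and \<open>q = pt\<close> (functions given on \<open>P\<close>).\<close>

definition pull :: "(('p \<times> 'p) set \<Rightarrow> 'z) \<Rightarrow> ('z \<Rightarrow> complex) \<Rightarrow> ('p \<times> 'p) set \<Rightarrow> complex"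
  where "pull q f = (\<lambda>\<tau>. if \<tau> \<in> topspace F then f (q \<tau>) else 0)"

lemma pull_apply [simp]: "v \<in> topspace P \<Longrightarrow> pull q f (arr u0 v) = f (q (arr u0 v))"
  by (simp add: pull_def)

text \<open>The target of \<open>[u0, v]\<close> does not change when \<open>v\<close> moves in its
  fibre, so the whole group serves as the neighbourhood of 1.\<close>

lemma pull_tgt_in_R:
  assumes "\<eta> \<in> compactly_supported X"
  shows "pull (tgt \<G>) \<eta> \<in> R"
proof -
  obtain b where b: "b > 0" "\<And>z. z \<in> topspace X \<Longrightarrow> cmod (\<eta> z) \<le> b"
    by (rule compactly_supported_bounded[OF assms]) (rule that)
  obtain K where c: "continuous_map X euclidean \<eta>" and K: "compactin X K"
    "\<forall>x \<in> topspace X - K. \<eta> x = 0"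
    using assms by (auto simp: compactly_supported_def)
  show ?thesis
  proof (rule R_algI[of _ b K])
    have "continuous_map F euclidean (\<eta> \<circ> (proj B \<circ> pt))"
      by (intro continuous_map_compose[OF _ c] continuous_map_compose[OF cont_pt cont_proj])
    then show "continuous_map F euclidean (pull (tgt \<G>) \<eta>)"
      by (rule continuous_map_eq) (use u0 in \<open>auto simp: topspace_F\<close>)
    fix \<epsilon> :: real assume "\<epsilon> > 0"
    then show "\<exists>V. openin T V \<and> unit \<in> V \<and> (\<forall>g\<in>V. \<forall>v\<in>topspace P.
        cmod (pull (tgt \<G>) \<eta> (arr u0 (v \<star> g)) - pull (tgt \<G>) \<eta> (arr u0 v)) < \<epsilon>)"
      using u0 openin_topspace[of T] by (intro exI[of _ G]) simp
  qed (use b K u0 in \<open>simp_all add: pull_def\<close>)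
qed

lemma base_bump:
  assumes "compactin X K"
  shows "\<exists>\<psi>\<in>compactly_supported X. \<forall>z\<in>K. \<psi> z = 1"
  by (rule bump_function[OF base_lc base_T2 assms openin_topspace compactin_subset_topspace[OF assms]])
    (rule bexI)

text \<open>Constants need not belong to \<open>R\<close>; a cutoff from the base that is 1 on the
  compact set carrying \<open>\<eta>\<close> acts as a unit for this one function.\<close>

lemma R_alg_local_unit:
  assumes "\<eta> \<in> R"
  obtains \<psi> where "\<psi> \<in> compactly_supported X" "\<forall>\<tau>. \<eta> \<tau> \<noteq> 0 \<longrightarrow> pull (tgt \<G>) \<psi> \<tau> = 1"
proof -
  obtain K where K: "compactin X K" "\<forall>\<tau> \<in> topspace F. tgt \<G> \<tau> \<notin> K \<longrightarrow> \<eta> \<tau> = 0"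
    using assms by (auto simp: R_alg_iff)
  obtain \<psi> where \<psi>: "\<psi> \<in> compactly_supported X" "\<forall>z\<in>K. \<psi> z = 1"
    using base_bump[OF K(1)] by blast
  moreover have "\<tau> \<in> topspace F" if "\<eta> \<tau> \<noteq> 0" for \<tau>
    using assms that by (auto simp: R_alg_iff)
  ultimately show thesis
    using K(2) by (intro that[of \<psi>]) (auto simp: pull_def)
qed

section \<open>Characters\<close>

lemma S_iff:
  "\<xi> \<in> topspace S \<longleftrightarrow> \<xi> \<in> extensional R \<and>
     (\<forall>f \<in> R. \<forall>g \<in> R. \<xi> (\<lambda>\<tau>. f \<tau> + g \<tau>) = \<xi> f + \<xi> g) \<and>
     (\<forall>f \<in> R. \<forall>g \<in> R. \<xi> (\<lambda>\<tau>. f \<tau> * g \<tau>) = \<xi> f * \<xi> g) \<and>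
     (\<forall>c. \<forall>f \<in> R. \<xi> (\<lambda>\<tau>. c * f \<tau>) = c * \<xi> f) \<and> (\<exists>f \<in> R. \<xi> f \<noteq> 0)"
  by (auto simp: S_space_def Gelfand_space_def PiE_def)

lemma S_add: "\<lbrakk>\<xi> \<in> topspace S; f \<in> R; g \<in> R\<rbrakk> \<Longrightarrow> \<xi> (\<lambda>\<tau>. f \<tau> + g \<tau>) = \<xi> f + \<xi> g"
  and S_mult: "\<lbrakk>\<xi> \<in> topspace S; f \<in> R; g \<in> R\<rbrakk> \<Longrightarrow> \<xi> (\<lambda>\<tau>. f \<tau> * g \<tau>) = \<xi> f * \<xi> g"
  and S_scale: "\<lbrakk>\<xi> \<in> topspace S; f \<in> R\<rbrakk> \<Longrightarrow> \<xi> (\<lambda>\<tau>. c * f \<tau>) = c * \<xi> f"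
  and S_nonzero: "\<xi> \<in> topspace S \<Longrightarrow> \<exists>f \<in> R. \<xi> f \<noteq> 0"
  by (simp_all add: S_iff)

text \<open>Multiplicativity, applied to \<open>\<eta>\<close> times its local unit, allows the
  nonzero value \<open>\<xi> \<eta>\<close> to be cancelled.\<close>

lemma character_local_unit:
  assumes \<xi>: "\<xi> \<in> topspace S" and \<eta>: "\<eta> \<in> R" "\<xi> \<eta> \<noteq> 0"
  obtains \<psi> where "\<psi> \<in> compactly_supported X"
    "\<forall>\<tau>. \<eta> \<tau> \<noteq> 0 \<longrightarrow> pull (tgt \<G>) \<psi> \<tau> = 1" "\<xi> (pull (tgt \<G>) \<psi>) = 1"
proof -
  obtain \<psi> where \<psi>: "\<psi> \<in> compactly_supported X"
    "\<forall>\<tau>. \<eta> \<tau> \<noteq> 0 \<longrightarrow> pull (tgt \<G>) \<psi> \<tau> = 1"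
    by (rule R_alg_local_unit[OF \<eta>(1)]) (rule that)
  have "\<eta> = (\<lambda>\<tau>. \<eta> \<tau> * pull (tgt \<G>) \<psi> \<tau>)"
  proof
    show "\<eta> \<tau> = \<eta> \<tau> * pull (tgt \<G>) \<psi> \<tau>" for \<tau>
      using \<psi>(2) by (cases "\<eta> \<tau> = 0") auto
  qed
  then have "\<xi> \<eta> = \<xi> (\<lambda>\<tau>. \<eta> \<tau> * pull (tgt \<G>) \<psi> \<tau>)" by simp
  also have "\<dots> = \<xi> \<eta> * \<xi> (pull (tgt \<G>) \<psi>)"
    by (rule S_mult[OF \<xi> \<eta>(1) pull_tgt_in_R[OF \<psi>(1)]])
  finally show thesis using \<psi> \<eta>(2) by (intro that[of \<psi>]) simp_all
qed

text \<open>If \<open>\<xi>\<close> were far from all points, then \<open>\<Psi> = \<Sum>|f - \<xi> f|\<^sup>2\<close>, cut off by a local unit, would lie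
  in the kernel of \<open>\<xi>\<close> and at the same time be invertible on the support of a function
  outside the kernel.\<close>

lemma character_approx:
  assumes \<xi>: "\<xi> \<in> topspace S" and J: "finite J" "J \<subseteq> R" and \<epsilon>: "\<epsilon> > 0"
  shows "\<exists>v\<in>topspace P. \<forall>f\<in>J. cmod (f (arr u0 v) - \<xi> f) < \<epsilon>"
proof (rule ccontr)
  assume "\<not> ?thesis"
  then have far: "\<exists>f\<in>J. cmod (f (arr u0 v) - \<xi> f) \<ge> \<epsilon>" if "v \<in> topspace P" for v
    using that by (meson not_le)
  obtain \<eta> where \<eta>: "\<eta> \<in> R" "\<xi> \<eta> \<noteq> 0" using S_nonzero[OF \<xi>] by blast
  obtain \<psi> where \<psi>: "\<psi> \<in> compactly_supported X"
    and e1: "\<forall>\<tau>. \<eta> \<tau> \<noteq> 0 \<longrightarrow> pull (tgt \<G>) \<psi> \<tau> = 1" and \<xi>e: "\<xi> (pull (tgt \<G>) \<psi>) = 1"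
    by (rule character_local_unit[OF \<xi> \<eta>]) (rule that)
  define e where "e = pull (tgt \<G>) \<psi>"
  have e: "e \<in> R" "\<xi> e = 1" using pull_tgt_in_R[OF \<psi>] \<xi>e by (simp_all add: e_def)
  \<comment> \<open>This is \<open>f - \<xi> f\<close> multiplied by the local unit, which replaces
    the constant function; \<open>\<xi> e = 1\<close> puts it into the kernel.\<close>
  define g where "g f = (\<lambda>\<tau>. f \<tau> * e \<tau> + (- \<xi> f) * e \<tau>)" for f
  have g: "g f \<in> R \<and> \<xi> (g f) = 0" if f: "f \<in> R" for f
  proof -
    note 1 = R_alg_mult[OF f e(1)] R_alg_scale[OF e(1), of "- \<xi> f"]
    have "\<xi> (g f) = \<xi> (\<lambda>\<tau>. f \<tau> * e \<tau>) + \<xi> (\<lambda>\<tau>. (- \<xi> f) * e \<tau>)"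
      unfolding g_def by (rule S_add[OF \<xi> 1])
    also have "\<dots> = 0"
      unfolding S_mult[OF \<xi> f e(1)] S_scale[OF \<xi> e(1)] e(2) by simp
    finally show ?thesis using R_alg_add[OF 1] by (simp add: g_def)
  qed
  define \<Psi> where "\<Psi> J = (\<lambda>\<tau>. \<Sum>f\<in>J. g f \<tau> * cnj (g f \<tau>))" for J
  have \<Psi>_ker: "\<Psi> J \<in> R \<and> \<xi> (\<Psi> J) = 0"
    using J
  proof (induction J rule: finite_induct)
    case empty
    have "(\<lambda>\<tau>. 0 * e \<tau>) \<in> R \<and> \<xi> (\<lambda>\<tau>. 0 * e \<tau>) = 0"
      using R_alg_scale[OF e(1), of 0] S_scale[OF \<xi> e(1), of 0] by simp
    then show ?case by (simp add: \<Psi>_def)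
  next
    case (insert f J)
    have eq: "\<Psi> (insert f J) = (\<lambda>\<tau>. g f \<tau> * cnj (g f \<tau>) + \<Psi> J \<tau>)"
      using insert.hyps by (simp add: \<Psi>_def)
    have f: "g f \<in> R" "\<xi> (g f) = 0" and IH: "\<Psi> J \<in> R" "\<xi> (\<Psi> J) = 0"
      using insert g by auto
    have c: "(\<lambda>\<tau>. cnj (g f \<tau>)) \<in> R" using f(1) by (rule R_alg_cnj)
    have m: "(\<lambda>\<tau>. g f \<tau> * cnj (g f \<tau>)) \<in> R" using f(1) c by (rule R_alg_mult)
    have "\<xi> (\<lambda>\<tau>. g f \<tau> * cnj (g f \<tau>)) = 0" using S_mult[OF \<xi> f(1) c] f(2) by simp
    then show ?case
      unfolding eq using R_alg_add[OF m IH(1)] S_add[OF \<xi> m IH(1)] IH(2) by simp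
  qed
  have \<Psi>_real: "\<Psi> J \<tau> = complex_of_real (\<Sum>f\<in>J. (cmod (g f \<tau>))\<^sup>2)" for \<tau>
    by (simp only: \<Psi>_def of_real_sum complex_norm_square)
  have \<Psi>_ge: "Re (\<Psi> J \<tau>) \<ge> \<epsilon>\<^sup>2" if "\<eta> \<tau> \<noteq> 0" for \<tau>
  proof -
    have "\<tau> \<in> topspace F" using \<eta>(1) that by (auto simp: R_alg_iff)
    then obtain f where f: "f \<in> J" "cmod (f \<tau> - \<xi> f) \<ge> \<epsilon>" using far by (auto simp: topspace_F)
    have "g f \<tau> = f \<tau> - \<xi> f" using e1 that by (simp add: g_def e_def)
    then have "\<epsilon>\<^sup>2 \<le> (cmod (g f \<tau>))\<^sup>2" using f(2) \<epsilon> by (simp add: power_mono)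
    also have "\<dots> \<le> (\<Sum>f\<in>J. (cmod (g f \<tau>))\<^sup>2)" using f(1) J(1) by (intro member_le_sum) auto
    finally show ?thesis by (simp add: \<Psi>_real)
  qed
  have \<epsilon>2: "\<epsilon>\<^sup>2 > 0" using \<epsilon> by simp
  \<comment> \<open>Where \<open>\<eta>\<close> is nonzero the sum is real and at least
    \<open>\<epsilon>\<^sup>2\<close>, so the cutoff is inactive and \<open>m\<close> times the sum
    gives back \<open>\<eta>\<close>; elsewhere both sides are 0.\<close>
  define m where "m = (\<lambda>\<tau>. \<eta> \<tau> / complex_of_real (max (\<epsilon>\<^sup>2) (Re (\<Psi> J \<tau>))))"
  have m: "m \<in> R" unfolding m_def using \<eta>(1) \<Psi>_ker \<epsilon>2 by (intro R_alg_divide_max) auto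
  have "\<eta> \<tau> = m \<tau> * \<Psi> J \<tau>" for \<tau>
  proof (cases "\<eta> \<tau> = 0")
    case False
    have ge: "max (\<epsilon>\<^sup>2) (Re (\<Psi> J \<tau>)) = Re (\<Psi> J \<tau>)" "Re (\<Psi> J \<tau>) \<noteq> 0"
      using \<epsilon>2 \<Psi>_ge[OF False] by auto
    have "complex_of_real (Re (\<Psi> J \<tau>)) = \<Psi> J \<tau>" by (simp add: \<Psi>_real)
    then have "m \<tau> = \<eta> \<tau> / \<Psi> J \<tau>" "\<Psi> J \<tau> \<noteq> 0" using ge by (auto simp: m_def)
    then show ?thesis by simp
  qed (simp add: m_def)
  then have "\<eta> = (\<lambda>\<tau>. m \<tau> * \<Psi> J \<tau>)" by (rule ext)
  then have "\<xi> \<eta> = \<xi> (\<lambda>\<tau>. m \<tau> * \<Psi> J \<tau>)" by simp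
  also have "\<dots> = 0" using S_mult[OF \<xi> m] \<Psi>_ker by simp
  finally show False using \<eta>(2) by simp
qed

text \<open>Boundedness of a character is automatic: each of its values is a limit of values of
  \<open>f\<close>. This places the characters in a product of discs.\<close>

lemma character_bound:
  assumes "\<xi> \<in> topspace S" "f \<in> R" "\<forall>\<tau>. cmod (f \<tau>) \<le> b"
  shows "cmod (\<xi> f) \<le> b"
proof (rule field_le_epsilon)
  fix \<epsilon> :: real assume "\<epsilon> > 0"
  then obtain v where v: "cmod (f (arr u0 v) - \<xi> f) < \<epsilon>"
    using character_approx[OF assms(1), of "{f}" \<epsilon>] assms(2) by auto
  have "cmod (\<xi> f) \<le> cmod (f (arr u0 v)) + cmod (f (arr u0 v) - \<xi> f)"
    by (metis norm_minus_commute norm_triangle_sub)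
  with v assms(3) show "cmod (\<xi> f) \<le> b + \<epsilon>" by (smt (verit))
qed

text \<open>For finitely many functions, a point of \<open>P\<close> approximating
  \<open>\<xi>\<close> is carried by \<open>q\<close> to an approximate solution, and
  \<open>\<eta>\<close> forces it into a fixed compact set; the finite intersection property then
  yields an exact one. With the base as \<open>Z\<close> this gives the anchor, with the flow as
  \<open>Z\<close> the extension of the orbit map.\<close>

lemma character_eval:
  assumes \<xi>: "\<xi> \<in> topspace S"
    and q: "\<And>v. v \<in> topspace P \<Longrightarrow> q (arr u0 v) \<in> topspace Z"
    and R: "\<And>f. f \<in> compactly_supported Z \<Longrightarrow> pull q f \<in> R"
    and \<eta>: "\<eta> \<in> compactly_supported Z" "\<xi> (pull q \<eta>) \<noteq> 0"
  shows "\<exists>z\<in>topspace Z. \<forall>f\<in>compactly_supported Z. \<xi> (pull q f) = f z"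
proof -
  obtain K where K: "compactin Z K" "\<forall>z \<in> topspace Z - K. \<eta> z = 0"
    using \<eta>(1) by (auto simp: compactly_supported_def)
  define C where "C f \<epsilon> = {z \<in> topspace Z. cmod (f z - \<xi> (pull q f)) \<in> {..\<epsilon>}}" for f and \<epsilon> :: real
  define \<I> where "\<I> = compactly_supported Z \<times> {0::real<..}"
  define \<U> where "\<U> = (\<lambda>(f, \<epsilon>). C f \<epsilon>) ` \<I>"
  have closed: "\<forall>D\<in>\<U>. closedin Z D"
  proof
    fix D assume "D \<in> \<U>"
    then obtain f \<epsilon> where D: "D = C f \<epsilon>" and "f \<in> compactly_supported Z" by (auto simp: \<U>_def \<I>_def)
    then have "continuous_map Z euclidean f" by (simp add: compactly_supported_def)
    then have "continuous_map Z euclidean (\<lambda>z. cmod (f z - \<xi> (pull q f)))"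
      by (intro continuous_map_norm continuous_map_diff) auto
    then show "closedin Z D" unfolding D C_def by (rule closedin_continuous_map_preimage) auto
  qed
  have fip: "K \<inter> \<Inter>\<F> \<noteq> {}" if \<F>: "finite \<F>" "\<F> \<subseteq> \<U>" for \<F>
  proof -
    obtain I where I: "I \<subseteq> \<I>" "finite I" "\<F> = (\<lambda>(f, \<epsilon>). C f \<epsilon>) ` I"
      using finite_subset_image[OF \<F>[unfolded \<U>_def]] by blast
    \<comment> \<open>The inserted value guarantees that \<open>\<eta>\<close> is nonzero at the
      approximating point, which puts that point into \<open>K\<close>; it also covers empty
      \<open>I\<close>.\<close>
    define \<epsilon> where "\<epsilon> = Min (insert (cmod (\<xi> (pull q \<eta>))) (snd ` I))"
    have \<epsilon>: "\<epsilon> > 0" "\<epsilon> \<le> cmod (\<xi> (pull q \<eta>))" "\<forall>i \<in> I. \<epsilon> \<le> snd i"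
      using I \<eta>(2) by (auto simp: \<epsilon>_def \<I>_def)
    define J where "J = pull q ` insert \<eta> (fst ` I)"
    have "finite J" "J \<subseteq> R" using R \<eta>(1) I(1,2) by (auto simp: \<I>_def J_def)
    then obtain v where v: "v \<in> topspace P" "\<forall>f\<in>J. cmod (f (arr u0 v) - \<xi> f) < \<epsilon>"
      using character_approx[OF \<xi> _ _ \<epsilon>(1), of J] by blast
    then have near: "cmod (f (q (arr u0 v)) - \<xi> (pull q f)) < \<epsilon>" if "f = \<eta> \<or> f \<in> fst ` I" for f
      using that by (auto simp: J_def)
    have "\<eta> (q (arr u0 v)) \<noteq> 0"
    proof
      assume "\<eta> (q (arr u0 v)) = 0"
      with near[of \<eta>] \<epsilon>(2) show False by simp
    qed
    then have "q (arr u0 v) \<in> K" using K(2) q[OF v(1)] by blast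
    moreover have "q (arr u0 v) \<in> C f d" if fd: "(f, d) \<in> I" for f d
    proof -
      have "cmod (f (q (arr u0 v)) - \<xi> (pull q f)) < \<epsilon>" using near[of f] fd by force
      moreover have "\<epsilon> \<le> d" using \<epsilon>(3) fd by auto
      ultimately show ?thesis using q[OF v(1)] by (simp add: C_def)
    qed
    ultimately show ?thesis using I(3) by auto
  qed
  have "K \<inter> \<Inter>\<U> \<noteq> {}"
    using iffD1[OF compactin_fip K(1)] closed fip by simp
  then obtain z where z: "z \<in> K" "\<forall>f \<in> compactly_supported Z. \<forall>\<epsilon>>0. z \<in> C f \<epsilon>"
    by (auto simp: \<U>_def \<I>_def)
  have "\<xi> (pull q f) = f z" if f: "f \<in> compactly_supported Z" for f
  proof -
    have "cmod (f z - \<xi> (pull q f)) \<le> 0"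
      by (rule field_le_epsilon) (use z(2) f in \<open>auto simp: C_def\<close>)
    then show ?thesis by simp
  qed
  then show ?thesis using z(1) compactin_subset_topspace[OF K(1)] by blast
qed

text \<open>The definite description is legitimate: existence is \<open>character_eval\<close> for
  the target map, with a local unit as the function not killed by \<open>\<xi>\<close>, and
  uniqueness is separation of points of the base.\<close>

lemma S_anchor_iff:
  assumes \<xi>: "\<xi> \<in> topspace S"
  shows "S_anchor B u0 \<xi> = x \<longleftrightarrow>
    x \<in> topspace X \<and> (\<forall>\<eta> \<in> compactly_supported X. \<xi> (pull (tgt \<G>) \<eta>) = \<eta> x)"
proof -
  let ?Q = "\<lambda>x. x \<in> topspace X \<and> (\<forall>\<eta> \<in> compactly_supported X. \<xi> (pull (tgt \<G>) \<eta>) = \<eta> x)"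
  have A: "S_anchor B u0 \<xi> = (THE x. ?Q x)"
    by (simp add: S_anchor_def Let_def pull_def)
  obtain \<eta> where \<eta>: "\<eta> \<in> R" "\<xi> \<eta> \<noteq> 0" using S_nonzero[OF \<xi>] by blast
  obtain \<psi> where \<psi>: "\<psi> \<in> compactly_supported X"
    "\<forall>\<tau>. \<eta> \<tau> \<noteq> 0 \<longrightarrow> pull (tgt \<G>) \<psi> \<tau> = 1" "\<xi> (pull (tgt \<G>) \<psi>) = 1"
    by (rule character_local_unit[OF \<xi> \<eta>]) (rule that)
  have "\<exists>x\<in>topspace X. \<forall>\<eta> \<in> compactly_supported X. \<xi> (pull (tgt \<G>) \<eta>) = \<eta> x"
    by (rule character_eval[OF \<xi> _ pull_tgt_in_R \<psi>(1)]) (use \<psi>(3) u0 in simp_all)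
  moreover have "x = y" if Q: "?Q x" "?Q y" for x y
  proof (rule compactly_supported_separates[OF base_lc base_T2])
    show "f x = f y" if "f \<in> compactly_supported X" for f
      using bspec[OF conjunct2[OF Q(1)] that] bspec[OF conjunct2[OF Q(2)] that] by simp
  qed (use Q in simp_all)
  ultimately have ex1: "\<exists>!x. ?Q x" by blast
  show ?thesis
  proof
    assume "S_anchor B u0 \<xi> = x"
    then show "?Q x" using theI'[OF ex1] unfolding A by (rule subst)
  next
    assume "?Q x"
    with ex1 show "S_anchor B u0 \<xi> = x" unfolding A by (rule the1_equality)
  qed
qed

lemma S_anchor_in: "\<xi> \<in> topspace S \<Longrightarrow> S_anchor B u0 \<xi> \<in> topspace X"
  and S_anchor_eval: "\<lbrakk>\<xi> \<in> topspace S; \<eta> \<in> compactly_supported X\<rbrakk> \<Longrightarrow>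
    \<xi> (pull (tgt \<G>) \<eta>) = \<eta> (S_anchor B u0 \<xi>)"
  using S_anchor_iff[of \<xi> "S_anchor B u0 \<xi>"] by simp_all

lemma S_embed_in:
  assumes v: "v \<in> topspace P"
  shows "S_embed B u0 (arr u0 v) \<in> topspace S"
proof -
  have "compactin X {proj B v}" using v by simp
  then obtain \<psi> where \<psi>: "\<psi> \<in> compactly_supported X" "\<psi> (proj B v) = 1"
    using base_bump by blast
  then have "pull (tgt \<G>) \<psi> \<in> R" "pull (tgt \<G>) \<psi> (arr u0 v) \<noteq> 0"
    using v u0 by (simp_all add: pull_tgt_in_R)
  then have "\<exists>f\<in>R. f (arr u0 v) \<noteq> 0" by blast
  then show ?thesis
    by (simp add: S_iff S_embed_def R_alg_add R_alg_mult R_alg_scale)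
qed

lemma S_anchor_embed:
  assumes v: "v \<in> topspace P"
  shows "S_anchor B u0 (S_embed B u0 (arr u0 v)) = proj B v"
  unfolding S_anchor_iff[OF S_embed_in[OF v]]
  using v u0 by (simp add: S_embed_def pull_tgt_in_R)

section \<open>The topology of the Gelfand space: density of \<open>P\<close> and properness of the
  anchor\<close>

lemma cont_eval: "f \<in> R \<Longrightarrow> continuous_map S euclidean (\<lambda>\<xi>. \<xi> f)"
  unfolding S_space_def Gelfand_space_def
  by (intro continuous_map_from_subtopology continuous_map_product_projection)

lemma S_T2: "Hausdorff_space S"
  unfolding S_space_def Gelfand_space_def
  by (intro Hausdorff_space_subtopology) (simp add: Hausdorff_space_product_topology)

text \<open>A basic neighbourhood in the product topology constrains only finitely many values of a
  character, which is the situation of \<open>character_approx\<close>.\<close>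

lemma S_embed_dense: "topspace S \<subseteq> S closure_of (S_embed B u0 ` arr u0 ` topspace P)"
proof
  fix \<xi> assume \<xi>: "\<xi> \<in> topspace S"
  show "\<xi> \<in> S closure_of (S_embed B u0 ` arr u0 ` topspace P)"
    unfolding in_closure_of
  proof (intro conjI allI impI \<xi>)
    fix W assume "\<xi> \<in> W \<and> openin S W"
    then have W: "openin S W" "\<xi> \<in> W" by auto
    obtain W' where W': "openin (product_topology (\<lambda>_. euclidean) R) W'" "W = W' \<inter> topspace S"
      using openin_subtopology_topspace[OF W(1)[unfolded S_space_def Gelfand_space_def]]
      unfolding S_space_def Gelfand_space_def by blast
    then have "\<xi> \<in> W'" using W(2) by blast
    with W'(1) obtain U where U: "finite {f \<in> R. U f \<noteq> UNIV}" "\<forall>f \<in> R. open (U f)"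
      "\<xi> \<in> Pi\<^sub>E R U" "Pi\<^sub>E R U \<subseteq> W'"
      unfolding openin_product_topology_alt by auto
    define J where "J = {f \<in> R. U f \<noteq> UNIV}"
    have "\<exists>d>0. ball (\<xi> f) d \<subseteq> U f" if f: "f \<in> R" for f
    proof (rule openE)
      show "open (U f)" "\<xi> f \<in> U f" using U(2) f PiE_mem[OF U(3) f] by auto
    qed (rule exI, rule conjI)
    then obtain d where d: "\<forall>f\<in>R. d f > 0 \<and> ball (\<xi> f) (d f) \<subseteq> U f" by metis
    define \<epsilon> where "\<epsilon> = Min (insert 1 (d ` J))"
    have J: "finite J" "J \<subseteq> R" using U(1) by (auto simp: J_def)
    then have \<epsilon>: "\<epsilon> > 0" "\<forall>f \<in> J. \<epsilon> \<le> d f"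
      using d by (auto simp: \<epsilon>_def)
    obtain v where v: "v \<in> topspace P" "\<forall>f \<in> J. cmod (f (arr u0 v) - \<xi> f) < \<epsilon>"
      using character_approx[OF \<xi> J \<epsilon>(1)] by blast
    have "f (arr u0 v) \<in> U f" if "f \<in> R" for f
    proof (cases "f \<in> J")
      case True
      then have "f (arr u0 v) \<in> ball (\<xi> f) (d f)"
        using v(2) \<epsilon>(2) by (force simp: dist_norm norm_minus_commute)
      then show ?thesis using d that by blast
    next
      case False
      then show ?thesis using that by (simp add: J_def)
    qed
    then have "S_embed B u0 (arr u0 v) \<in> Pi\<^sub>E R U"
      by (simp add: PiE_def S_embed_def)
    then have "S_embed B u0 (arr u0 v) \<in> W" using U(4) W'(2) S_embed_in[OF v(1)] by blast
    then show "\<exists>y. y \<in> S_embed B u0 ` arr u0 ` topspace P \<and> y \<in> W" using v(1) by blast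
  qed
qed

text \<open>A Banach-Alaoglu argument over a compact \<open>K\<close>: all characters lie in the
  Tychonoff product of the discs of radius \<open>b f\<close>, where the algebraic identities cut
  out a closed set.\<close>

lemma proper_S_anchor:
  assumes cont: "continuous_map S X (S_anchor B u0)"
  shows "proper_map S X (S_anchor B u0)"
proof (rule compact_imp_proper_map)
  show "k_space X" using base_lc by (rule locally_compact_imp_k_space)
  show "kc_space X" using base_T2 by (rule Hausdorff_imp_kc_space)
  show "S_anchor B u0 \<in> topspace S \<rightarrow> topspace X" using S_anchor_in by auto
  show "continuous_map S X (S_anchor B u0) \<or> kc_space S" using cont by simp
  fix K assume K: "compactin X K"
  obtain \<psi> where \<psi>: "\<psi> \<in> compactly_supported X" "\<forall>z\<in>K. \<psi> z = 1"
    using base_bump[OF K] by blast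
  have \<psi>R: "pull (tgt \<G>) \<psi> \<in> R" using \<psi>(1) by (rule pull_tgt_in_R)
  have "\<forall>f\<in>R. \<exists>b. \<forall>\<tau>. cmod (f \<tau>) \<le> b"
  proof
    fix f assume "f \<in> R"
    then show "\<exists>b. \<forall>\<tau>. cmod (f \<tau>) \<le> b" by (rule R_alg_bounded) (rule exI)
  qed
  then obtain b where b: "\<forall>f\<in>R. \<forall>\<tau>. cmod (f \<tau>) \<le> b f" by metis
  define Pr where "Pr = (product_topology (\<lambda>_. euclidean) R :: ((('p \<times> 'p) set \<Rightarrow> complex) \<Rightarrow> complex) topology)"
  define D where "D = PiE R (\<lambda>f. cball (0::complex) (b f))"
  have D: "compactin Pr D" by (simp add: compactin_PiE Pr_def D_def)
  define C1 where "C1 f g = {\<xi> \<in> topspace Pr. \<xi> (\<lambda>\<tau>. f \<tau> + g \<tau>) - (\<xi> f + \<xi> g) \<in> {0}}" for f g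
  define C2 where "C2 f g = {\<xi> \<in> topspace Pr. \<xi> (\<lambda>\<tau>. f \<tau> * g \<tau>) - \<xi> f * \<xi> g \<in> {0}}" for f g
  define C3 where "C3 c f = {\<xi> \<in> topspace Pr. \<xi> (\<lambda>\<tau>. c * f \<tau>) - c * \<xi> f \<in> {0}}" for c f
  \<comment> \<open>Being nonzero is not a closed condition. Taking the value 1 at the cutoff is
    closed, implies it, and holds for every character anchored in \<open>K\<close>.\<close>
  define C4 where "C4 = {\<xi> \<in> topspace Pr. \<xi> (pull (tgt \<G>) \<psi>) \<in> {1}}"
  define C where "C = (\<Inter>f\<in>R. \<Inter>g\<in>R. C1 f g \<inter> C2 f g) \<inter> (\<Inter>c. \<Inter>f\<in>R. C3 c f) \<inter> C4"
  have p: "continuous_map Pr euclidean (\<lambda>\<xi>. \<xi> f)" if "f \<in> R" for f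
    unfolding Pr_def using that by (rule continuous_map_product_projection)
  have "closedin Pr (C1 f g)" if "f \<in> R" "g \<in> R" for f g
    unfolding C1_def
    by (rule closedin_continuous_map_preimage[of _ euclidean])
      (intro continuous_map_diff continuous_map_add p R_alg_add that, simp)
  moreover have "closedin Pr (C2 f g)" if "f \<in> R" "g \<in> R" for f g
    unfolding C2_def
    by (rule closedin_continuous_map_preimage[of _ euclidean])
      (intro continuous_map_diff continuous_map_complex_mult p R_alg_mult that, simp)
  moreover have "closedin Pr (C3 c f)" if "f \<in> R" for c f
    unfolding C3_def
    by (rule closedin_continuous_map_preimage[of _ euclidean])
      (intro continuous_map_diff continuous_map_complex_mult p R_alg_scale that continuous_map_const[THEN iffD2], simp_all)
  moreover have "closedin Pr C4"
    unfolding C4_def by (rule closedin_continuous_map_preimage[OF p[OF \<psi>R]]) auto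
  ultimately have "closedin Pr C"
    unfolding C_def using \<psi>R by (intro closedin_Int closedin_INT) auto
  then have cpt: "compactin Pr (C \<inter> D)" using D by (rule closed_Int_compactin)
  have sub: "C \<inter> D \<subseteq> topspace S"
  proof
    fix \<xi> assume \<xi>: "\<xi> \<in> C \<inter> D"
    then have "\<xi> \<in> C1 f g" "\<xi> \<in> C2 f g" "\<xi> \<in> C3 c f" if "f \<in> R" "g \<in> R" for f g c
      using that unfolding C_def Int_iff INT_iff by simp_all
    moreover have "\<xi> \<in> C4" using \<xi> unfolding C_def by simp
    then have "\<xi> (pull (tgt \<G>) \<psi>) \<noteq> 0" by (simp add: C4_def)
    then have "\<exists>f\<in>R. \<xi> f \<noteq> 0" using \<psi>R by blast
    moreover have "\<xi> \<in> extensional R" using \<xi> by (simp add: PiE_def D_def)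
    ultimately show "\<xi> \<in> topspace S"
      unfolding S_iff C1_def C2_def C3_def by simp
  qed
  have "compactin S (C \<inter> D)"
    using cpt sub unfolding S_space_def Gelfand_space_def Pr_def by (auto simp: compactin_subtopology)
  moreover have "{\<xi> \<in> topspace S. S_anchor B u0 \<xi> \<in> K} \<subseteq> C \<inter> D"
  proof
    fix \<xi> assume "\<xi> \<in> {\<xi> \<in> topspace S. S_anchor B u0 \<xi> \<in> K}"
    then have \<xi>: "\<xi> \<in> topspace S" "\<psi> (S_anchor B u0 \<xi>) = 1" using \<psi>(2) by auto
    then have "\<xi> \<in> topspace Pr" by (simp add: S_iff PiE_def Pr_def)
    then have "\<xi> \<in> C"
      using \<xi> S_anchor_eval[OF \<xi>(1) \<psi>(1)]
      by (simp add: C_def C1_def C2_def C3_def C4_def S_add S_mult S_scale)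
    moreover have "cmod (\<xi> f) \<le> b f" if "f \<in> R" for f
      using character_bound[OF \<xi>(1) that] b that by blast
    then have "\<xi> \<in> D" using \<xi>(1) by (simp add: S_iff PiE_def D_def)
    ultimately show "\<xi> \<in> C \<inter> D" by blast
  qed
  \<comment> \<open>The cutoff may equal 1 outside \<open>K\<close> as well, so
    \<open>C \<inter> D\<close> can be larger than the preimage, which is compact as a closed subset
    of it.\<close>
  moreover have "closedin S {\<xi> \<in> topspace S. S_anchor B u0 \<xi> \<in> K}"
    using cont compactin_imp_closedin[OF base_T2 K] by (rule closedin_continuous_map_preimage)
  ultimately show "compactin S {\<xi> \<in> topspace S. S_anchor B u0 \<xi> \<in> K}"
    by (rule closed_compactin)
qed

section \<open>Orbit maps are uniformly continuous\<close>

text \<open>The single arrow \<open>[e, e b] = [e k, e b k]\<close> moves \<open>i (e k)\<close> to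
  \<open>i (e b k)\<close> for every \<open>k\<close>, so uniformity over the compact fibre becomes
  uniformity in \<open>k\<close>. The map \<open>i\<close> is abstract because it is the orbit map
  into the flow in one use and the embedding into \<open>S\<close> in the other.\<close>

lemma orbit_uniform_left:
  assumes act: "right_action \<G> Y \<rho> \<alpha>"
    and e: "e \<in> topspace P"
    and cpt: "compactin Y {y \<in> topspace Y. \<rho> y = proj B e}"
    and i: "\<And>v. v \<in> topspace P \<Longrightarrow> i v \<in> topspace Y" "\<And>v. v \<in> topspace P \<Longrightarrow> \<rho> (i v) = proj B v"
      "\<And>v w. \<lbrakk>v \<in> topspace P; w \<in> topspace P\<rbrakk> \<Longrightarrow> \<alpha> (i v) (arr v w) = i w"
    and h: "continuous_map Y euclidean h" and \<epsilon>: "\<epsilon> > 0"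
  shows "\<exists>N. openin T N \<and> unit \<in> N \<and>
    (\<forall>b\<in>N. \<forall>k\<in>G. cmod (h (i (e \<star> (b \<odot> k))) - h (i (e \<star> k))) < \<epsilon>)"
proof -
  have c: "continuous_map T (arrs \<G>) (\<lambda>b. arr e (e \<star> b))"
    by (intro cont_arr cont_act_const) (use e in simp_all)
  have src: "src \<G> (arr e (e \<star> b)) = proj B e" if "b \<in> topspace T" for b
    using that e by simp
  have unit: "unit \<in> topspace T" "arr e (e \<star> unit) = idt \<G> (proj B e)"
    using e by (simp_all add: idt_proj)
  obtain N where N: "openin T N" "unit \<in> N"
    "\<And>b y. \<lbrakk>b \<in> N; y \<in> topspace Y; \<rho> y = proj B e\<rbrakk> \<Longrightarrow> cmod (h (\<alpha> y (arr e (e \<star> b))) - h y) < \<epsilon>"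
    by (rule right_action_uniform_near_unit[OF act cpt c src unit h \<epsilon>]) (assumption | rule that)+
  have "cmod (h (i (e \<star> (b \<odot> k))) - h (i (e \<star> k))) < \<epsilon>" if b: "b \<in> N" and k: "k \<in> G" for b k
  proof -
    have bG: "b \<in> G" using openin_subset[OF N(1)] b by auto
    have "arr e (e \<star> b) = arr (e \<star> k) (e \<star> (b \<odot> k))"
      using arr_act[of e "e \<star> b" k] e k bG by simp
    then have "\<alpha> (i (e \<star> k)) (arr e (e \<star> b)) = i (e \<star> (b \<odot> k))"
      using i(3) e k bG by simp
    then show ?thesis using N(3)[OF b, of "i (e \<star> k)"] i e k by simp
  qed
  with N(1,2) show ?thesis by blast
qed

end

text \<open>A flow with proper anchor and a base point over \<open>x0\<close>, the point to which
  \<open>u0\<close> is to be sent. Density of orbits enters only when the factor map is shown to be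
  onto.\<close>

locale ambit_and_flow = principal_bundle_at B u0
  for B :: "('g, 'p, 'x) bundle_data" and u0 +
  fixes \<alpha> and M :: "'m topology" and \<rho> \<beta> m0
  assumes extends: "extended_action B u0 \<alpha>"
    and flow: "right_action \<G> M \<rho> \<beta>" and flow_T2: "Hausdorff_space M"
    and flow_proper: "proper_map M X \<rho>"
    and m0: "m0 \<in> topspace M" "\<rho> m0 = x0"
begin

text \<open>The orbit map of \<open>m0\<close>, read on \<open>P\<close> through the identification
  of \<open>v\<close> with \<open>[u0, v]\<close>.\<close>

abbreviation "n v \<equiv> \<beta> m0 (arr u0 v)"

lemma S_act: "right_action \<G> S (S_anchor B u0) \<alpha>"
  and \<alpha>_embed: "\<lbrakk>v \<in> topspace P; w \<in> topspace P\<rbrakk> \<Longrightarrow>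
    \<alpha> (S_embed B u0 (arr u0 v)) (arr v w) = S_embed B u0 (arr u0 w)"
  using extends by (auto simp: extended_action_def)

lemma cont_anchor: "continuous_map S X (S_anchor B u0)"
  using S_act by (simp add: right_action_def)

lemma cont_\<rho>: "continuous_map M X \<rho>"
  using flow by (simp add: right_action_def)

lemma flow_lc: "locally_compact_space M"
  using flow_proper cont_\<rho> base_lc by (rule proper_map_locally_compact_domain)

lemma n_in [simp]: "v \<in> topspace P \<Longrightarrow> n v \<in> topspace M"
  by (rule right_action_in[OF flow]) (use m0 u0 in simp_all)

lemma \<rho>_n [simp]: "v \<in> topspace P \<Longrightarrow> \<rho> (n v) = proj B v"
  using right_action_anchor[OF flow, of m0 "arr u0 v"] m0 u0 by simp

lemma \<beta>_n: "\<lbrakk>v \<in> topspace P; w \<in> topspace P\<rbrakk> \<Longrightarrow> \<beta> (n v) (arr v w) = n w"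
  using right_action_cmp[OF flow, of m0 "arr u0 v" "arr v w"] m0 u0 by simp

lemma cont_n:
  assumes "continuous_map Z P c"
  shows "continuous_map Z M (\<lambda>z. n (c z))"
proof (rule right_action_continuous[OF flow])
  show "continuous_map Z (arrs \<G>) (\<lambda>z. arr u0 (c z))"
    using assms u0 by (intro cont_arr) simp_all
  show "src \<G> (arr u0 (c z)) = \<rho> m0" if "z \<in> topspace Z" for z
    using continuous_map_image_subset_topspace[OF assms] that u0 m0 by (auto simp: image_subset_iff)
qed (use m0 in simp)

lemma fibre_compact: "x \<in> topspace X \<Longrightarrow> compactin M {m \<in> topspace M. \<rho> m = x}"
  using flow_proper by (simp add: proper_map_def)

lemma S_fibre_compact: "x \<in> topspace X \<Longrightarrow> compactin S {\<xi> \<in> topspace S. S_anchor B u0 \<xi> = x}"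
  using proper_S_anchor[OF cont_anchor] by (simp add: proper_map_def)

text \<open>The defining condition of \<open>R\<close> controls translations of \<open>G\<close> on the side opposite to the one
  that the action on a compact fibre controls. Inversion in the fibre exchanges the two sides:
  a bump times \<open>k \<mapsto> f (n (e k\<^sup>-\<^sup>1))\<close> lies in \<open>R\<close>, and continuity of the action on the compact
  fibre of \<open>S\<close> then yields the missing side.\<close>

lemma orbit_uniform_right:
  assumes f: "f \<in> compactly_supported M" and x: "x \<in> topspace X"
    and U: "openin X U" "x \<in> U"
    and \<sigma>: "continuous_map (subtopology X U) P \<sigma>" "\<And>y. y \<in> U \<Longrightarrow> proj B (\<sigma> y) = y"
    and \<kappa>: "continuous_map (subtopology P {v \<in> topspace P. proj B v \<in> U}) T \<kappa>"
      "\<And>v g. \<lbrakk>v \<in> topspace P; proj B v \<in> U; g \<in> G\<rbrakk> \<Longrightarrow> \<kappa> (v \<star> g) = \<kappa> v \<odot> g"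
      "\<And>y. y \<in> U \<Longrightarrow> \<kappa> (\<sigma> y) = unit"
    and e: "e = \<sigma> x" and \<epsilon>: "\<epsilon> > 0"
  shows "\<exists>N. openin T N \<and> unit \<in> N \<and>
    (\<forall>b\<in>N. \<forall>k\<in>G. cmod (f (n (e \<star> (k \<odot> b))) - f (n (e \<star> k))) < \<epsilon>)"
proof -
  have eP: "e \<in> topspace P" and pe: "proj B e = x" and \<kappa>e: "\<kappa> e = unit"
    using \<sigma> U \<kappa>(3) x continuous_map_image_subset_topspace[OF \<sigma>(1)] by (auto simp: e)
  have \<kappa>G: "\<kappa> v \<in> G" if "v \<in> topspace P" "proj B v \<in> U" for v
    using continuous_map_image_subset_topspace[OF \<kappa>(1)] that by auto
  have fc: "continuous_map M euclidean f" using f by (simp add: compactly_supported_def)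
  obtain b0 where b0: "b0 > 0" "\<And>z. z \<in> topspace M \<Longrightarrow> cmod (f z) \<le> b0"
    by (rule compactly_supported_bounded[OF f]) (rule that)
  obtain \<psi> L where \<psi>: "\<psi> \<in> compactly_supported X" "\<psi> x = 1"
    "compactin X L" "L \<subseteq> U" "\<forall>z\<in>topspace X - L. \<psi> z = 0" "\<forall>z\<in>topspace X. cmod (\<psi> z) \<le> 1"
    by (rule bump_function_at[OF base_lc base_T2 U]) (rule that)
  have \<psi>c: "continuous_map X euclidean \<psi>" using \<psi>(1) by (simp add: compactly_supported_def)
  define Q where "Q v = \<psi> (proj B v) * f (n (e \<star> inver (\<kappa> v)))" for v
  define q where "q v = (if proj B v \<in> U then Q v else 0)" for v
  let ?PU = "{v \<in> topspace P. proj B v \<in> U}"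
  have Qc: "continuous_map (subtopology P ?PU) euclidean Q"
  proof -
    have "continuous_map (subtopology P ?PU) M (\<lambda>v. n (e \<star> inver (\<kappa> v)))"
      by (intro cont_n cont_act_const cont_inv_comp \<kappa>(1)) (use eP in simp)
    then have 1: "continuous_map (subtopology P ?PU) euclidean (\<lambda>v. f (n (e \<star> inver (\<kappa> v))))"
      using continuous_map_compose[OF _ fc] by (simp add: o_def)
    have "continuous_map (subtopology P ?PU) X (proj B)"
      using cont_proj by (rule continuous_map_from_subtopology)
    then have "continuous_map (subtopology P ?PU) euclidean (\<lambda>v. \<psi> (proj B v))"
      using continuous_map_compose[OF _ \<psi>c] by (simp add: o_def)
    with 1 show ?thesis unfolding Q_def by (intro continuous_map_complex_mult)
  qed
  have qc: "continuous_map P euclidean q"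
  \<comment> \<open>As \<open>L\<close> is closed, the chart and the part of \<open>P\<close> over
    the complement of \<open>L\<close> form an open cover; on the overlap the bump vanishes, so
    \<open>Q\<close> and 0 agree.\<close>
  proof (rule pasting_lemma[where I = UNIV and T = "\<lambda>b. if b then ?PU else {v \<in> topspace P. proj B v \<in> topspace X - L}"
        and f = "\<lambda>b. if b then Q else (\<lambda>_. 0)"])
    have "closedin X L" using base_T2 \<psi>(3) by (rule compactin_imp_closedin)
    then show "openin P (if b then ?PU else {v \<in> topspace P. proj B v \<in> topspace X - L})" for b
      using openin_continuous_map_preimage[OF cont_proj U(1)]
        openin_continuous_map_preimage[OF cont_proj, of "topspace X - L"] by (simp add: openin_diff)
    show "continuous_map (subtopology P (if b then ?PU else {v \<in> topspace P. proj B v \<in> topspace X - L}))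
        euclidean (if b then Q else (\<lambda>_. 0))" for b
      using Qc by simp
    show "(if i then Q else (\<lambda>_. 0)) v = (if j then Q else (\<lambda>_. 0)) v"
      if "v \<in> topspace P \<inter> (if i then ?PU else {v \<in> topspace P. proj B v \<in> topspace X - L})
          \<inter> (if j then ?PU else {v \<in> topspace P. proj B v \<in> topspace X - L})" for i j v
      using that \<psi>(5) by (auto simp: Q_def split: if_splits)
    show "\<exists>j. j \<in> UNIV \<and> v \<in> (if j then ?PU else {v \<in> topspace P. proj B v \<in> topspace X - L}) \<and>
        q v = (if j then Q else (\<lambda>_. 0)) v" if v: "v \<in> topspace P" for v
    proof (cases "proj B v \<in> U")
      case True
      then show ?thesis using v by (intro exI[of _ True]) (simp add: q_def)
    next
      case False
      then show ?thesis using v \<psi>(4) by (intro exI[of _ False]) (auto simp: q_def)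
    qed
  qed
  define \<phi> where "\<phi> = pull pt q"
  have \<phi>: "\<phi> (arr u0 v) = q v" if "v \<in> topspace P" for v using that by (simp add: \<phi>_def)
  have \<phi>R: "\<phi> \<in> R"
  proof (rule R_algI[of _ b0 L])
    show "\<phi> \<tau> = 0" if "\<tau> \<notin> topspace F" for \<tau> using that by (simp add: \<phi>_def pull_def)
    show "cmod (\<phi> (arr u0 v)) \<le> b0" if v: "v \<in> topspace P" for v
    proof (cases "proj B v \<in> U")
      case True
      have "cmod (f (n (e \<star> inver (\<kappa> v)))) \<le> b0"
        using b0(2) n_in[OF act_closed[OF eP inv_closed[OF \<kappa>G[OF v True]]]] by blast
      moreover have "cmod (\<psi> (proj B v)) \<le> 1" using \<psi>(6) v by simp
      ultimately have "cmod (Q v) \<le> 1 * b0"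
        unfolding Q_def norm_mult by (intro mult_mono) simp_all
      then show ?thesis using True by (simp add: \<phi>[OF v] q_def)
    qed (use v b0 in \<open>simp add: \<phi> q_def\<close>)
    have "continuous_map F euclidean (q \<circ> pt)" using cont_pt qc by (rule continuous_map_compose)
    then show "continuous_map F euclidean \<phi>"
      by (rule continuous_map_eq) (simp add: \<phi>_def pull_def)
    show "compactin X L" by fact
    show "\<phi> (arr u0 v) = 0" if v: "v \<in> topspace P" "proj B v \<notin> L" for v
      using v \<psi>(5) by (simp add: \<phi> q_def Q_def)
    fix d :: real assume d: "d > 0"
    obtain N where N: "openin T N" "unit \<in> N"
      "\<forall>b\<in>N. \<forall>k\<in>G. cmod (f (n (e \<star> (b \<odot> k))) - f (n (e \<star> k))) < d"
      using orbit_uniform_left[OF flow eP fibre_compact n_in \<rho>_n \<beta>_n fc d] eP by auto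
    \<comment> \<open>The coordinate of \<open>v \<star> g\<close> has inverse
      \<open>inver g \<odot> inver (\<kappa> v)\<close>: a right translation of \<open>v\<close> by
      \<open>g\<close> is a left translation by \<open>inver g\<close> in the argument of
      \<open>f\<close>, hence the inverted neighbourhood.\<close>
    define V where "V = {g \<in> topspace T. inver g \<in> N}"
    have "cmod (\<phi> (arr u0 (v \<star> g)) - \<phi> (arr u0 v)) < d" if g: "g \<in> V" and v: "v \<in> topspace P" for g v
    proof (cases "proj B v \<in> U")
      case True
      have gG: "g \<in> G" "inver g \<in> N" using g by (simp_all add: V_def)
      have kG: "\<kappa> v \<in> G" using \<kappa>G[OF v True] .
      have "\<phi> (arr u0 (v \<star> g)) - \<phi> (arr u0 v)
          = \<psi> (proj B v) * (f (n (e \<star> (inver g \<odot> inver (\<kappa> v)))) - f (n (e \<star> inver (\<kappa> v))))"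
        using True v gG kG by (simp add: \<phi> q_def Q_def \<kappa>(2) inv_mult_group right_diff_distrib)
      also have "cmod \<dots> \<le> 1 * cmod (f (n (e \<star> (inver g \<odot> inver (\<kappa> v)))) - f (n (e \<star> inver (\<kappa> v))))"
        unfolding norm_mult using \<psi>(6) v by (intro mult_right_mono) simp_all
      also have "\<dots> < d" using N(3) gG kG by simp
      finally show ?thesis .
    next
      case False
      have "g \<in> G" using g by (simp add: V_def)
      then show ?thesis using False v d by (simp add: \<phi> q_def)
    qed
    moreover have "openin T V" unfolding V_def by (rule openin_continuous_map_preimage[OF cont_inv N(1)])
    moreover have "unit \<in> V" using N(2) by (simp add: V_def)
    ultimately show "\<exists>V. openin T V \<and> unit \<in> V \<and>
        (\<forall>g\<in>V. \<forall>v\<in>topspace P. cmod (\<phi> (arr u0 (v \<star> g)) - \<phi> (arr u0 v)) < d)" by blast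
  qed
  have "compactin S {\<xi> \<in> topspace S. S_anchor B u0 \<xi> = proj B e}"
    using S_fibre_compact eP by simp
  \<comment> \<open>The same left estimate, now for the embedding of \<open>P\<close> into
    \<open>S\<close> and evaluation at \<open>\<phi>\<close>; continuity of the extended action is
    used here.\<close>
  from orbit_uniform_left[OF S_act eP this S_embed_in S_anchor_embed \<alpha>_embed cont_eval[OF \<phi>R] \<epsilon>]
  obtain N where N: "openin T N" "unit \<in> N"
    "\<forall>b\<in>N. \<forall>k\<in>G. cmod (S_embed B u0 (arr u0 (e \<star> (b \<odot> k))) \<phi> - S_embed B u0 (arr u0 (e \<star> k)) \<phi>) < \<epsilon>"
    by auto
  \<comment> \<open>At \<open>e \<star> k\<close> the coordinate is \<open>k\<close> and the bump is
    1. Substituting inverses then turns the left estimate in \<open>S\<close> into the right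
    estimate for \<open>f\<close>.\<close>
  have val: "S_embed B u0 (arr u0 (e \<star> k)) \<phi> = f (n (e \<star> inver k))" if "k \<in> G" for k
    using that eP \<phi>R U pe \<kappa>(2)[of e k] \<kappa>e \<psi>(2) by (simp add: S_embed_def \<phi> q_def Q_def)
  define V where "V = {g \<in> topspace T. inver g \<in> N}"
  have "cmod (f (n (e \<star> (k \<odot> b))) - f (n (e \<star> k))) < \<epsilon>" if "b \<in> V" "k \<in> G" for b k
  proof -
    have b: "b \<in> G" "inver b \<in> N" using that by (simp_all add: V_def)
    have "cmod (S_embed B u0 (arr u0 (e \<star> (inver b \<odot> inver k))) \<phi> - S_embed B u0 (arr u0 (e \<star> inver k)) \<phi>) < \<epsilon>"
      using N(3) b(2) that(2) by simp
    then show ?thesis using b that(2) by (simp add: val inv_mult_group)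
  qed
  moreover have "openin T V" unfolding V_def by (rule openin_continuous_map_preimage[OF cont_inv N(1)])
  moreover have "unit \<in> V" using N(2) by (simp add: V_def)
  ultimately show ?thesis by blast
qed

text \<open>Three terms of size \<open>\<epsilon> / 3\<close>. For \<open>y\<close> near
  \<open>x\<close> the arrow \<open>[e, \<sigma> y]\<close> is near a unit and compares
  \<open>\<sigma> y \<star> k\<close> with \<open>e \<star> k\<close> uniformly in \<open>k\<close>;
  it is used at \<open>k\<close> and at \<open>k \<odot> g\<close>, and
  \<open>orbit_uniform_right\<close> compares the two in the fibre over \<open>x\<close>.\<close>

lemma orbit_locally_uniform:
  assumes f: "f \<in> compactly_supported M" and x: "x \<in> topspace X" and \<epsilon>: "\<epsilon> > 0"
  shows "\<exists>U V. openin X U \<and> x \<in> U \<and> openin T V \<and> unit \<in> V \<and>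
    (\<forall>g\<in>V. \<forall>v\<in>topspace P. proj B v \<in> U \<longrightarrow> cmod (f (n (v \<star> g)) - f (n v)) < \<epsilon>)"
proof -
  obtain U \<sigma> \<kappa> where U: "openin X U" "x \<in> U"
    and \<sigma>: "continuous_map (subtopology X U) P \<sigma>" "\<And>y. y \<in> U \<Longrightarrow> proj B (\<sigma> y) = y"
    and \<kappa>: "continuous_map (subtopology P {v \<in> topspace P. proj B v \<in> U}) T \<kappa>"
    and dec: "\<And>v. \<lbrakk>v \<in> topspace P; proj B v \<in> U\<rbrakk> \<Longrightarrow> v = \<sigma> (proj B v) \<star> \<kappa> v"
    and \<kappa>': "\<And>v g. \<lbrakk>v \<in> topspace P; proj B v \<in> U; g \<in> G\<rbrakk> \<Longrightarrow> \<kappa> (v \<star> g) = \<kappa> v \<odot> g"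
      "\<And>y. y \<in> U \<Longrightarrow> \<kappa> (\<sigma> y) = unit"
    by (rule local_trivialization[OF x]) (rule that)
  define e where "e = \<sigma> x"
  have \<sigma>P: "\<sigma> y \<in> topspace P" if "y \<in> U" for y
    using continuous_map_image_subset_topspace[OF \<sigma>(1)] openin_subset[OF U(1)] that by auto
  have \<kappa>G: "\<kappa> v \<in> G" if "v \<in> topspace P" "proj B v \<in> U" for v
    using continuous_map_image_subset_topspace[OF \<kappa>] that by auto
  have eP: "e \<in> topspace P" "proj B e = x" using \<sigma>P \<sigma>(2) U by (simp_all add: e_def)
  have fc: "continuous_map M euclidean f" using f by (simp add: compactly_supported_def)
  have \<epsilon>3: "\<epsilon> / 3 > 0" using \<epsilon> by simp
  obtain V where V: "openin T V" "unit \<in> V"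
    "\<forall>b\<in>V. \<forall>k\<in>G. cmod (f (n (e \<star> (k \<odot> b))) - f (n (e \<star> k))) < \<epsilon> / 3"
    using orbit_uniform_right[OF f x U \<sigma> \<kappa> \<kappa>' e_def \<epsilon>3] by blast
  have c: "continuous_map (subtopology X U) (arrs \<G>) (\<lambda>y. arr e (\<sigma> y))"
    by (intro cont_arr \<sigma>(1)) (use eP in simp)
  have src: "src \<G> (arr e (\<sigma> y)) = x" if "y \<in> topspace (subtopology X U)" for y
    using that eP \<sigma>P by simp
  have xU: "x \<in> topspace (subtopology X U)" using x U by simp
  have idt: "arr e (\<sigma> x) = idt \<G> x" using idt_proj[OF eP(1)] eP(2) by (simp add: e_def)
  obtain N where N: "openin (subtopology X U) N" "x \<in> N"
    "\<And>y m. \<lbrakk>y \<in> N; m \<in> topspace M; \<rho> m = x\<rbrakk> \<Longrightarrow> cmod (f (\<beta> m (arr e (\<sigma> y))) - f m) < \<epsilon> / 3"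
    by (rule right_action_uniform_near_unit[OF flow fibre_compact[OF x] c src xU idt fc \<epsilon>3])
      (assumption | rule that)+
  have NU: "N \<subseteq> U" using openin_subset[OF N(1)] by auto
  have near: "cmod (f (n (\<sigma> y \<star> k)) - f (n (e \<star> k))) < \<epsilon> / 3" if y: "y \<in> N" and k: "k \<in> G" for y k
  proof -
    have yP: "\<sigma> y \<in> topspace P" using \<sigma>P NU y by blast
    have "arr e (\<sigma> y) = arr (e \<star> k) (\<sigma> y \<star> k)" using eP yP k by simp
    then have "\<beta> (n (e \<star> k)) (arr e (\<sigma> y)) = n (\<sigma> y \<star> k)"
      using \<beta>_n[of "e \<star> k" "\<sigma> y \<star> k"] eP yP k by simp
    then show ?thesis using N(3)[OF y, of "n (e \<star> k)"] eP k by simp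
  qed
  have "cmod (f (n (v \<star> g)) - f (n v)) < \<epsilon>"
    if g: "g \<in> V" and v: "v \<in> topspace P" and vN: "proj B v \<in> N" for g v
  proof -
    have gG: "g \<in> G" using openin_subset[OF V(1)] g by auto
    have vU: "proj B v \<in> U" using vN NU by blast
    define k where "k = \<kappa> v"
    have kG: "k \<in> G" using \<kappa>G[OF v vU] by (simp add: k_def)
    have v': "v = \<sigma> (proj B v) \<star> k" using dec[OF v vU] by (simp add: k_def)
    then have vg: "v \<star> g = \<sigma> (proj B v) \<star> (k \<odot> g)"
      using act_act[OF \<sigma>P[OF vU] kG gG] by simp
    have "cmod (f (n (\<sigma> (proj B v) \<star> (k \<odot> g))) - f (n (e \<star> (k \<odot> g)))) < \<epsilon> / 3"
      using near[OF vN] kG gG by simp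
    moreover have "cmod (f (n (\<sigma> (proj B v) \<star> k)) - f (n (e \<star> k))) < \<epsilon> / 3"
      using near[OF vN kG] .
    moreover have "cmod (f (n (e \<star> (k \<odot> g))) - f (n (e \<star> k))) < \<epsilon> / 3"
      using V(3) g kG by blast
    ultimately have "cmod (f (n (\<sigma> (proj B v) \<star> (k \<odot> g))) - f (n (\<sigma> (proj B v) \<star> k))) < \<epsilon>"
      by norm
    then show ?thesis using vg v' by simp
  qed
  moreover have "openin X N" using N(1) U(1) by (rule openin_trans_full)
  ultimately show ?thesis using N(2) V(1,2) by blast
qed

text \<open>The function lives over the compact image \<open>K\<close> of the support of
  \<open>f\<close>, so finitely many local estimates suffice and their neighbourhoods can be
  intersected. Off \<open>K\<close> both compared values are 0, because right translation stays in
  the fibre.\<close>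

lemma orbit_function_in_R:
  assumes f: "f \<in> compactly_supported M"
  shows "pull (\<beta> m0) f \<in> R"
proof -
  obtain b where b: "b > 0" "\<And>z. z \<in> topspace M \<Longrightarrow> cmod (f z) \<le> b"
    by (rule compactly_supported_bounded[OF f]) (rule that)
  obtain L where fc: "continuous_map M euclidean f" and L: "compactin M L"
    "\<forall>z \<in> topspace M - L. f z = 0"
    using f by (auto simp: compactly_supported_def)
  define K where "K = \<rho> ` L"
  have K: "compactin X K" unfolding K_def using L(1) cont_\<rho> by (rule image_compactin)
  have zero: "f (n v) = 0" if v: "v \<in> topspace P" "proj B v \<notin> K" for v
  proof -
    have "n v \<notin> L" using \<rho>_n[OF v(1)] v(2) unfolding K_def by (metis imageI)
    then show ?thesis using L(2) n_in[OF v(1)] by blast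
  qed
  show ?thesis
  proof (rule R_algI[of _ b K])
    show "pull (\<beta> m0) f \<tau> = 0" if "\<tau> \<notin> topspace F" for \<tau> using that by (simp add: pull_def)
    show "cmod (pull (\<beta> m0) f (arr u0 v)) \<le> b" if "v \<in> topspace P" for v using that b by simp
    have "continuous_map F M (\<lambda>\<tau>. \<beta> m0 \<tau>)"
    proof (rule right_action_continuous[OF flow])
      show "continuous_map F (arrs \<G>) (\<lambda>\<tau>. \<tau>)"
        unfolding source_fibre_def by (intro continuous_map_from_subtopology) simp
      show "src \<G> \<tau> = \<rho> m0" if "\<tau> \<in> topspace F" for \<tau> using that m0 u0 by (auto simp: topspace_F)
    qed (use m0 in simp)
    then have "continuous_map F euclidean (f \<circ> \<beta> m0)" using fc by (rule continuous_map_compose)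
    then show "continuous_map F euclidean (pull (\<beta> m0) f)"
      by (rule continuous_map_eq) (simp add: pull_def)
    show "compactin X K" by fact
    show "pull (\<beta> m0) f (arr u0 v) = 0" if "v \<in> topspace P" "proj B v \<notin> K" for v
      using that zero by simp
    fix \<epsilon> :: real assume \<epsilon>: "\<epsilon> > 0"
    have "\<forall>x\<in>K. \<exists>U V. openin X U \<and> x \<in> U \<and> openin T V \<and> unit \<in> V \<and>
      (\<forall>g\<in>V. \<forall>v\<in>topspace P. proj B v \<in> U \<longrightarrow> cmod (f (n (v \<star> g)) - f (n v)) < \<epsilon>)"
      using orbit_locally_uniform[OF f _ \<epsilon>] compactin_subset_topspace[OF K] by (meson subsetD)
    then obtain U V where UV: "\<forall>x\<in>K. openin X (U x) \<and> x \<in> U x \<and> openin T (V x) \<and> unit \<in> V x \<and>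
      (\<forall>g\<in>V x. \<forall>v\<in>topspace P. proj B v \<in> U x \<longrightarrow> cmod (f (n (v \<star> g)) - f (n v)) < \<epsilon>)"
      by (metis (no_types))
    have "\<exists>\<F>. finite \<F> \<and> \<F> \<subseteq> U ` K \<and> K \<subseteq> \<Union>\<F>"
      using K UV by (intro compactinD[OF K]) auto
    then obtain \<F> where \<F>: "finite \<F>" "\<F> \<subseteq> U ` K" "K \<subseteq> \<Union>\<F>" by blast
    obtain I where "I \<subseteq> K" "finite I" "\<F> = U ` I"
      using finite_subset_image[OF \<F>(1,2)] by blast
    then have I: "finite I" "I \<subseteq> K" "K \<subseteq> \<Union>(U ` I)" using \<F>(3) by auto
    \<comment> \<open>For empty \<open>I\<close> the bare intersection would be the universe of the
      type, hence the explicit carrier.\<close>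
    define W where "W = topspace T \<inter> \<Inter>(V ` I)"
    have "openin T W"
      unfolding W_def using I UV openin_topspace[of T]
      by (cases "I = {}") (auto intro!: openin_Int openin_Inter)
    moreover have "unit \<in> W" using I UV by (auto simp: W_def)
    moreover have "cmod (f (n (v \<star> g)) - f (n v)) < \<epsilon>" if g: "g \<in> W" and v: "v \<in> topspace P" for g v
    proof (cases "proj B v \<in> K")
      case True
      then obtain x where "x \<in> I" "proj B v \<in> U x" using I(3) by blast
      moreover have "g \<in> V x" using g \<open>x \<in> I\<close> by (simp add: W_def)
      ultimately show ?thesis using UV I(2) v by blast
    next
      case False
      have "g \<in> G" using g by (simp add: W_def)
      then show ?thesis using False v zero[of v] zero[of "v \<star> g"] \<epsilon> by simp
    qed
    ultimately have W: "openin T W" "unit \<in> W"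
      "\<forall>g\<in>W. \<forall>v\<in>topspace P. cmod (f (n (v \<star> g)) - f (n v)) < \<epsilon>" by blast+
    then show "\<exists>V. openin T V \<and> unit \<in> V \<and> (\<forall>g\<in>V. \<forall>v\<in>topspace P.
        cmod (pull (\<beta> m0) f (arr u0 (v \<star> g)) - pull (\<beta> m0) f (arr u0 v)) < \<epsilon>)"
      using openin_subset[OF W(1)] by (intro exI[of _ W]) auto
  qed
qed

section \<open>Extension of orbit maps to the Gelfand space\<close>

text \<open>Gelfand duality for the compactly supported functions on \<open>M\<close>: they separate
  points, so at most one point qualifies and the choice operator merely names it.\<close>

definition "\<Phi> \<xi> = (SOME z. z \<in> topspace M \<and> (\<forall>f\<in>compactly_supported M. \<xi> (pull (\<beta> m0) f) = f z))"

text \<open>Along the orbit the anchor equals the target. This gives both the nonvanishing needed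
  for \<open>\<Phi>\<close> to exist and the fact that \<open>\<Phi>\<close> lies over the
  base.\<close>

lemma pull_anchor: "pull (\<beta> m0) (\<lambda>m. \<psi> (\<rho> m)) = pull (tgt \<G>) \<psi>"
  by (rule ext) (use u0 in \<open>auto simp: pull_def topspace_F\<close>)

text \<open>The function not killed by \<open>\<xi>\<close> is a cutoff on the base with value 1 at
  the anchor of \<open>\<xi>\<close>, pulled back along the proper anchor of
  \<open>M\<close>.\<close>

lemma \<Phi>:
  assumes \<xi>: "\<xi> \<in> topspace S"
  shows "\<Phi> \<xi> \<in> topspace M \<and> (\<forall>f\<in>compactly_supported M. \<xi> (pull (\<beta> m0) f) = f (\<Phi> \<xi>))"
proof -
  have "compactin X {S_anchor B u0 \<xi>}" using S_anchor_in[OF \<xi>] by simp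
  then obtain \<psi> where \<psi>: "\<psi> \<in> compactly_supported X" "\<psi> (S_anchor B u0 \<xi>) = 1"
    using base_bump by blast
  have "\<xi> (pull (\<beta> m0) (\<lambda>m. \<psi> (\<rho> m))) \<noteq> 0"
    using S_anchor_eval[OF \<xi> \<psi>(1)] \<psi>(2) by (simp add: pull_anchor)
  then have "\<exists>z\<in>topspace M. \<forall>f\<in>compactly_supported M. \<xi> (pull (\<beta> m0) f) = f z"
    by (intro character_eval[OF \<xi> n_in orbit_function_in_R
          compactly_supported_compose_proper[OF \<psi>(1) flow_proper cont_\<rho>]])
  then have "\<exists>z. z \<in> topspace M \<and> (\<forall>f\<in>compactly_supported M. \<xi> (pull (\<beta> m0) f) = f z)"
    by blast
  then show ?thesis unfolding \<Phi>_def by (rule someI_ex)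
qed

lemma \<Phi>_in [simp]: "\<xi> \<in> topspace S \<Longrightarrow> \<Phi> \<xi> \<in> topspace M"
  using \<Phi>[of \<xi>] by simp

lemma \<Phi>_eval: "\<lbrakk>\<xi> \<in> topspace S; f \<in> compactly_supported M\<rbrakk> \<Longrightarrow> f (\<Phi> \<xi>) = \<xi> (pull (\<beta> m0) f)"
  using \<Phi>[of \<xi>] by simp

section \<open>Continuity, anchor and equivariance of the extension\<close>

lemma cont_\<Phi>: "continuous_map S M \<Phi>"
proof (rule continuous_map_compactly_supportedI[OF flow_lc flow_T2])
  fix f assume f: "f \<in> compactly_supported M"
  show "continuous_map S euclidean (\<lambda>\<xi>. f (\<Phi> \<xi>))"
    by (rule continuous_map_eq[OF cont_eval[OF orbit_function_in_R[OF f]]]) (simp add: \<Phi>_eval f)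
qed simp

lemma \<rho>_\<Phi>:
  assumes \<xi>: "\<xi> \<in> topspace S"
  shows "\<rho> (\<Phi> \<xi>) = S_anchor B u0 \<xi>"
proof (rule compactly_supported_separates[OF base_lc base_T2])
  show "\<rho> (\<Phi> \<xi>) \<in> topspace X"
    using continuous_map_image_subset_topspace[OF cont_\<rho>] \<Phi>_in[OF \<xi>] by blast
  show "S_anchor B u0 \<xi> \<in> topspace X" using \<xi> by (rule S_anchor_in)
  fix \<psi> assume \<psi>: "\<psi> \<in> compactly_supported X"
  show "\<psi> (\<rho> (\<Phi> \<xi>)) = \<psi> (S_anchor B u0 \<xi>)"
    using \<Phi>_eval[OF \<xi> compactly_supported_compose_proper[OF \<psi> flow_proper cont_\<rho>]]
      S_anchor_eval[OF \<xi> \<psi>] by (simp add: pull_anchor)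
qed

lemma \<Phi>_embed:
  assumes v: "v \<in> topspace P"
  shows "\<Phi> (S_embed B u0 (arr u0 v)) = n v"
proof (rule compactly_supported_separates[OF flow_lc flow_T2])
  fix f assume f: "f \<in> compactly_supported M"
  show "f (\<Phi> (S_embed B u0 (arr u0 v))) = f (n v)"
    unfolding \<Phi>_eval[OF S_embed_in[OF v] f]
    using v orbit_function_in_R[OF f] by (simp add: S_embed_def)
qed (use v S_embed_in in simp_all)

text \<open>Equivariance holds on the dense image of \<open>P\<close>. Since arrows starting at different points
  have to be compared, the arrow is first extended along a local section.\<close>

lemma \<Phi>_equivariant:
  assumes \<xi>: "\<xi> \<in> topspace S" and g: "g \<in> topspace (arrs \<G>)" and src: "src \<G> g = S_anchor B u0 \<xi>"
  shows "\<Phi> (\<alpha> \<xi> g) = \<beta> (\<Phi> \<xi>) g"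
proof -
  define x where "x = S_anchor B u0 \<xi>"
  obtain v w where vw: "g = arr v w" "v \<in> topspace P" "w \<in> topspace P"
    using g by (auto simp: topspace_arrs)
  have px: "proj B v = x" using src vw by (simp add: x_def)
  obtain U \<sigma> \<kappa> where U: "openin X U" "x \<in> U"
    and \<sigma>: "continuous_map (subtopology X U) P \<sigma>" "\<And>y. y \<in> U \<Longrightarrow> proj B (\<sigma> y) = y"
    and "continuous_map (subtopology P {v \<in> topspace P. proj B v \<in> U}) T \<kappa>"
    and "\<And>v. \<lbrakk>v \<in> topspace P; proj B v \<in> U\<rbrakk> \<Longrightarrow> v = \<sigma> (proj B v) \<star> \<kappa> v"
    and "\<And>v g. \<lbrakk>v \<in> topspace P; proj B v \<in> U; g \<in> G\<rbrakk> \<Longrightarrow> \<kappa> (v \<star> g) = \<kappa> v \<odot> g"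
    and "\<And>y. y \<in> U \<Longrightarrow> \<kappa> (\<sigma> y) = unit"
    by (rule local_trivialization[OF S_anchor_in[OF \<xi>, folded x_def]]) (rule that)
  have \<sigma>P: "\<sigma> y \<in> topspace P" if "y \<in> U" for y
    using continuous_map_image_subset_topspace[OF \<sigma>(1)] openin_subset[OF U(1)] that by auto
  obtain h where h: "h \<in> G" "v \<star> h = \<sigma> x"
    using act_ex1[OF vw(2) \<sigma>P[OF U(2)]] \<sigma>(2)[OF U(2)] px by auto
  define w' where "w' = w \<star> h"
  have w': "w' \<in> topspace P" using vw h by (simp add: w'_def)
  have g_eq: "g = arr (\<sigma> x) w'"
    using arr_act[OF vw(2,3) h(1)] by (simp add: vw(1) h(2) w'_def)
  define A where "A = {\<zeta> \<in> topspace S. S_anchor B u0 \<zeta> \<in> U}"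
  \<comment> \<open>The end \<open>w'\<close> is fixed and only the start moves along the section,
    so these arrows vary continuously, are composable with \<open>\<zeta>\<close>, and equal
    \<open>g\<close> at \<open>\<xi>\<close>.\<close>
  define c where "c \<zeta> = arr (\<sigma> (S_anchor B u0 \<zeta>)) w'" for \<zeta>
  have A: "openin S A" unfolding A_def by (rule openin_continuous_map_preimage[OF cont_anchor U(1)])
  have \<xi>A: "\<xi> \<in> A" using \<xi> U(2) by (simp add: A_def x_def)
  have "continuous_map (subtopology S A) (subtopology X U) (S_anchor B u0)"
    using cont_anchor by (auto simp: continuous_map_in_subtopology continuous_map_from_subtopology A_def)
  from continuous_map_compose[OF this \<sigma>(1)]
  have cc: "continuous_map (subtopology S A) (arrs \<G>) c"
    unfolding c_def using w' by (intro cont_arr) (simp_all add: o_def)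
  have src_c: "src \<G> (c \<zeta>) = S_anchor B u0 \<zeta>" if "\<zeta> \<in> A" for \<zeta>
    using that \<sigma>P \<sigma>(2) w' by (simp add: c_def A_def)
  have "continuous_map (subtopology S A) S (\<lambda>\<zeta>. \<alpha> \<zeta> (c \<zeta>))"
    by (rule right_action_continuous[OF S_act _ cc])
      (use src_c in \<open>auto intro: continuous_map_from_subtopology\<close>)
  from continuous_map_compose[OF this cont_\<Phi>]
  have 1: "continuous_map (subtopology S A) M (\<lambda>\<zeta>. \<Phi> (\<alpha> \<zeta> (c \<zeta>)))" by (simp add: o_def)
  have 2: "continuous_map (subtopology S A) M (\<lambda>\<zeta>. \<beta> (\<Phi> \<zeta>) (c \<zeta>))"
    by (rule right_action_continuous[OF flow _ cc])
      (use src_c \<rho>_\<Phi> cont_\<Phi> in \<open>auto intro: continuous_map_from_subtopology\<close>)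
  let ?D = "S_embed B u0 ` arr u0 ` topspace P"
  have agree: "\<Phi> (\<alpha> \<zeta> (c \<zeta>)) = \<beta> (\<Phi> \<zeta>) (c \<zeta>)" if \<zeta>: "\<zeta> \<in> A \<inter> ?D" for \<zeta>
  proof -
    obtain u where u: "u \<in> topspace P" and \<zeta>_eq: "\<zeta> = S_embed B u0 (arr u0 u)" using \<zeta> by auto
    have an: "S_anchor B u0 \<zeta> = proj B u" unfolding \<zeta>_eq using u by (rule S_anchor_embed)
    then have uU: "proj B u \<in> U" using \<zeta> by (simp add: A_def)
    obtain k where k: "k \<in> G" "\<sigma> (proj B u) \<star> k = u"
      using act_ex1[OF \<sigma>P[OF uU] u] \<sigma>(2)[OF uU] by auto
    have c_eq: "c \<zeta> = arr u (w' \<star> k)"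
      using arr_act[OF \<sigma>P[OF uU] w' k(1)] by (simp add: c_def an k(2))
    have wk: "w' \<star> k \<in> topspace P" using w' k by simp
    show ?thesis
      unfolding c_eq unfolding \<zeta>_eq \<alpha>_embed[OF u wk] \<Phi>_embed[OF u] \<Phi>_embed[OF wk] \<beta>_n[OF u wk] ..
  qed
  \<comment> \<open>As \<open>A\<close> is open, density of \<open>P\<close> in \<open>S\<close>
    passes to \<open>A\<close>; two continuous maps into a Hausdorff space that agree on
    \<open>A \<inter> ?D\<close> then agree at \<open>\<xi>\<close>.\<close>
  have "\<xi> \<in> subtopology S A closure_of (A \<inter> ?D)"
    using openin_Int_closure_of_subset[OF A, of ?D] S_embed_dense \<xi> \<xi>A A
    by (auto simp: closure_of_subtopology_open)
  from forall_in_closure_of_eq[OF this flow_T2 1 2 agree]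
  show ?thesis by (simp add: c_def g_eq flip: x_def)
qed

lemma factor_onto_minimal:
  assumes N: "closedin S N" "N \<noteq> {}" "\<And>\<xi>. \<xi> \<in> N \<Longrightarrow> orbit \<G> (S_anchor B u0) \<alpha> \<xi> \<subseteq> N"
    and dense: "\<And>m. m \<in> topspace M \<Longrightarrow> M closure_of (orbit \<G> \<rho> \<beta> m) = topspace M"
  shows "groupoid_map \<G> (subtopology S N) (S_anchor B u0) \<alpha> M \<rho> \<beta> \<Phi>" "\<Phi> ` N = topspace M"
proof -
  have NS: "N \<subseteq> topspace S" using N(1) by (rule closedin_subset)
  have c: "continuous_map (subtopology S N) M \<Phi>"
    using cont_\<Phi> by (rule continuous_map_from_subtopology)
  show "groupoid_map \<G> (subtopology S N) (S_anchor B u0) \<alpha> M \<rho> \<beta> \<Phi>"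
    using c by (simp add: groupoid_map_def \<rho>_\<Phi> \<Phi>_equivariant)
  have "proper_map (subtopology S N) X (S_anchor B u0)"
    using proper_S_anchor[OF cont_anchor] N(1) by (rule proper_map_closedin_domain)
  then have "proper_map (subtopology S N) X (\<rho> \<circ> \<Phi>)"
    by (rule proper_map_cong) (simp add: \<rho>_\<Phi>)
  \<comment> \<open>Properness passes from \<open>\<rho> \<circ> \<Phi>\<close> to its first factor
    because \<open>M\<close> is Hausdorff; this is what makes the image of \<open>N\<close>
    closed.\<close>
  then have "proper_map (subtopology S N) M \<Phi>"
    by (rule proper_map_from_composition_right[OF flow_T2 _ c cont_\<rho>])
  moreover have "closedin (subtopology S N) N"
    using closedin_topspace[of "subtopology S N"] NS by (simp add: inf.absorb2)
  ultimately have closed: "closedin M (\<Phi> ` N)"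
    by (simp add: proper_map_def closed_map_def)
  obtain \<xi> where \<xi>: "\<xi> \<in> N" using N(2) by blast
  then have \<xi>S: "\<xi> \<in> topspace S" using NS by blast
  have "orbit \<G> \<rho> \<beta> (\<Phi> \<xi>) \<subseteq> \<Phi> ` N"
  proof
    fix m assume "m \<in> orbit \<G> \<rho> \<beta> (\<Phi> \<xi>)"
    then obtain g where g: "m = \<beta> (\<Phi> \<xi>) g" "g \<in> topspace (arrs \<G>)" "src \<G> g = S_anchor B u0 \<xi>"
      by (auto simp: orbit_def \<rho>_\<Phi>[OF \<xi>S])
    then have "m = \<Phi> (\<alpha> \<xi> g)" using \<Phi>_equivariant[OF \<xi>S] by simp
    moreover have "\<alpha> \<xi> g \<in> N" using N(3)[OF \<xi>] g(2,3) by (auto simp: orbit_def)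
    ultimately show "m \<in> \<Phi> ` N" by blast
  qed
  then have "M closure_of (orbit \<G> \<rho> \<beta> (\<Phi> \<xi>)) \<subseteq> \<Phi> ` N" using closed by (rule closure_of_minimal)
  then have "topspace M \<subseteq> \<Phi> ` N" using dense[OF \<Phi>_in[OF \<xi>S]] by simp
  moreover have "\<Phi> ` N \<subseteq> topspace M" using NS by auto
  ultimately show "\<Phi> ` N = topspace M" by blast
qed

end

section \<open>Choice of a base point and universality\<close>

theorem mainTheorem5:
  fixes B :: "('g, 'p, 'x) bundle_data"
    and u0 :: 'p
    and \<alpha> :: "((('p \<times> 'p) set \<Rightarrow> complex) \<Rightarrow> complex) \<Rightarrow> ('p \<times> 'p) set \<Rightarrow>
              ((('p \<times> 'p) set \<Rightarrow> complex) \<Rightarrow> complex)"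
    and MP :: "((('p \<times> 'p) set \<Rightarrow> complex) \<Rightarrow> complex) set"
  assumes "principal_bundle B"
    and "has_bounded_right_invariant_metric (grp B) (grp_top B)"
    and "locally_compact_space (base_space B)"
    and "locally_contractible_space (base_space B)"
    and "u0 \<in> topspace (tot_space B)"
    and "extended_action B u0 \<alpha>"
    and "minimal_subflow (gauge_groupoid B) (S_space B u0) (S_anchor B u0) \<alpha> MP"
  shows "minimal_flow (gauge_groupoid B) (subtopology (S_space B u0) MP) (S_anchor B u0) \<alpha> \<and>
         (\<forall>(M :: 'm topology) \<rho> \<beta>. minimal_flow (gauge_groupoid B) M \<rho> \<beta> \<longrightarrow>
            (\<exists>\<phi>. groupoid_map (gauge_groupoid B)
                    (subtopology (S_space B u0) MP) (S_anchor B u0) \<alpha> M \<rho> \<beta> \<phi> \<and>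
                  \<phi> ` MP = topspace M))"
proof -
  interpret principal_bundle_at B u0
    by unfold_locales (use assms in auto)
  have act: "right_action \<G> S (S_anchor B u0) \<alpha>"
    using assms(6) by (simp add: extended_action_def)
  have cont: "continuous_map S X (S_anchor B u0)"
    using act by (simp add: right_action_def)
  have MP: "closedin S MP" "MP \<noteq> {}"
    "\<And>\<xi>. \<xi> \<in> MP \<Longrightarrow> orbit \<G> (S_anchor B u0) \<alpha> \<xi> \<subseteq> MP"
    "\<And>\<xi>. \<xi> \<in> MP \<Longrightarrow> subtopology S MP closure_of (orbit \<G> (S_anchor B u0) \<alpha> \<xi>) = MP"
    using assms(7) by (auto simp: minimal_subflow_def)
  have top: "topspace (subtopology S MP) = MP"
    using closedin_subset[OF MP(1)] by auto
  have "minimal_flow \<G> (subtopology S MP) (S_anchor B u0) \<alpha>"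
    unfolding minimal_flow_def top objs_gauge
  proof (intro conjI ballI MP(2))
    show "Hausdorff_space (subtopology S MP)" using S_T2 by (rule Hausdorff_space_subtopology)
    show "right_action \<G> (subtopology S MP) (S_anchor B u0) \<alpha>"
      using act MP(3) by (rule right_action_subtopology)
    show "proper_map (subtopology S MP) X (S_anchor B u0)"
      using proper_S_anchor[OF cont] MP(1) by (rule proper_map_closedin_domain)
  qed (rule MP(4))
  moreover have "\<exists>\<phi>. groupoid_map \<G> (subtopology S MP) (S_anchor B u0) \<alpha> M \<rho> \<beta> \<phi> \<and> \<phi> ` MP = topspace M"
    if M: "minimal_flow \<G> M \<rho> \<beta>" for M :: "'m topology" and \<rho> \<beta>
  proof -
    have flow: "right_action \<G> M \<rho> \<beta>" "Hausdorff_space M" "proper_map M X \<rho>"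
      and dense: "\<And>m. m \<in> topspace M \<Longrightarrow> M closure_of (orbit \<G> \<rho> \<beta> m) = topspace M"
      and ne: "topspace M \<noteq> {}"
      using M by (auto simp: minimal_flow_def)
    \<comment> \<open>Any point of the flow will do: an arrow \<open>[v, u0]\<close> with
      \<open>v\<close> over \<open>\<rho> m\<close> transports it to the fibre over
      \<open>x0\<close>, which gives the base point required by the locale.\<close>
    obtain m where m: "m \<in> topspace M" using ne by blast
    have "continuous_map M X \<rho>" using flow(1) by (simp add: right_action_def)
    then have "\<rho> m \<in> topspace X" using m continuous_map_image_subset_topspace by blast
    then obtain v where v: "v \<in> topspace P" "proj B v = \<rho> m" using proj_surj by (metis imageE)
    have arr: "arr v u0 \<in> topspace (arrs \<G>)" "src \<G> (arr v u0) = \<rho> m" "tgt \<G> (arr v u0) = x0"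
      using v u0 by simp_all
    interpret ambit_and_flow B u0 \<alpha> M \<rho> \<beta> "\<beta> m (arr v u0)"
    proof unfold_locales
      show "\<beta> m (arr v u0) \<in> topspace M" by (rule right_action_in[OF flow(1) m arr(1,2)])
      show "\<rho> (\<beta> m (arr v u0)) = x0"
        using right_action_anchor[OF flow(1) m arr(1,2)] arr(3) by simp
    qed (use assms(6) flow in auto)
    show ?thesis using factor_onto_minimal[OF MP(1-3) dense] by blast
  qed
  ultimately show ?thesis by blast
qed

end
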